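(* Let $P$ be a probability measure on $\Omega$ such that: (i) the random variables $\{\omega^x\}_{x\in\mathbb{Z}}$ are i.i.d. under $P$; (ii) for $P$-a.e. $\omega$, the Markov chain with transition probabilities $\omega$ is irreducible on $\mathbb{Z}$; (iii) there exist positive integers $L,R$ such that for $P$-a.e. $\omega$, $\omega(a,b)=0$ for all $a\in\mathbb{Z}$ and all integers $b$ outside $[a-L,a+R]$; (iv) for $P$-a.e. $\omega$, $\lim_{n\to\infty}X_n=\infty$, $P_\omega^0$-a.s. Let $v$ be the limiting velocity, i.e. the constant such that $\lim_{n\to\infty}\frac{X_n}{n}=v$, $\mathbb{P}^0$-a.s. Then the following are equivalent: (a) The walk is ballistic: $v>0$. (b) $\mathbb{E}^0[H_{\ge1}]<\infty$. (c) $\mathbb{E}^0[N_0]=E\big[E_\omega^0[N_0]\big]<\infty$.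
   Context: An environment on $\mathbb{Z}$ is a function $\omega:\mathbb{Z}\times\mathbb{Z}\to[0,1]$ with $\sum_{y\in\mathbb{Z}}\omega(x,y)=1$ for every $x\in\mathbb{Z}$. For $x\in\mathbb{Z}$, $\omega^x$ is the probability measure on $\mathbb{Z}$ given by $\omega^x(y)=\omega(x,x+y)$; $\omega$ is identified with $(\omega^x)_{x\in\mathbb{Z}}$. Let $\mathcal{M}_1(\mathbb{Z})$ be the set of probability measures on $\mathbb{Z}$ with the topology of weak convergence, and let $\Omega=\prod_{x\in\mathbb{Z}}\mathcal{M}_1(\mathbb{Z})$ with the Borel sigma-field of the product topology. For an environment $\omega$ and $x\in\mathbb{Z}$, the quenched measure $P_\omega^x$ (expectation $E_\omega^x$) is the law on $\mathbb{Z}^{\mathbb{N}}$ (with $0\in\mathbb{N}$) of the Markov chain $\mathbf{X}=(X_n)_{n\ge0}$ with $X_0=x$ and transition probabilities $P_\omega^x(X_{n+1}=y\mid X_0,\dots,X_n)=\omega(X_n,y)$. Given a probability measure $P$ on $\Omega$ (expectation $E$), the annealed measure $\mathbb{P}^x$ (expectation $\mathbb{E}^x$) on $\Omega\times\mathbb{Z}^{\mathbb{N}}$ is $\mathbb{P}^x(A\times B)=\int_A P_\omega^x(B)\,P(d\omega)$. Under hypotheses (i)–(iii) the $\mathbb{P}^0$-a.s. limit $v=\lim_{n\to\infty}X_n/n$ exists and is a deterministic constant. $H_{\ge x}=\inf\{n\in\mathbb{N}:X_n\ge x\}$, and $N_x=\#\{n\in\mathbb{N}:X_n=x\}$ is the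 total number of visits to $x\in\mathbb{Z}$. *)

theory Defs
  imports "HOL-Probability.Probability"
begin

section \<open>The space of environments\<close>

definition borel_of :: "'a topology \<Rightarrow> 'a measure" where
  "borel_of T = sigma (topspace T) {U. openin T U}"

text \<open>
  Probability measures on the integers are represented by the type \<open>int pmf\<close>.  The integers are
  discrete, so every bounded function on them is continuous, and the topology of weak convergence
  is the coarsest one that makes all integrals of bounded functions continuous.
\<close>

definition weak_topology :: "int pmf topology" where
  "weak_topology = topology_generated_by
     {{p. measure_pmf.expectation p f \<in> U} | (f :: int \<Rightarrow> real) U. bounded (range f) \<and> open U}"

definition env_topology :: "(int \<Rightarrow> int pmf) topology" where
  "env_topology = product_topology (\<lambda>_. weak_topology) UNIV"

text \<open>
  The measure returned by \<open>borel_of\<close> only matters through its carrier and its \<open>\<sigma>\<close>-algebra.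
\<close>

abbreviation law_space :: "int pmf measure" where
  "law_space \<equiv> borel_of weak_topology"

abbreviation env_space :: "(int \<Rightarrow> int pmf) measure" where
  "env_space \<equiv> borel_of env_topology"

text \<open>
  An environment is stored as the family of its jump distributions: \<open>\<omega> a\<close> is the law of the jump
  made from \<open>a\<close>.  The probability of moving from \<open>a\<close> to \<open>b\<close> is therefore the mass of \<open>b - a\<close>.
\<close>

definition trans_prob :: "(int \<Rightarrow> int pmf) \<Rightarrow> int \<Rightarrow> int \<Rightarrow> real" where
  "trans_prob \<omega> a b = pmf (\<omega> a) (b - a)"


section \<open>The quenched and annealed laws\<close>

abbreviation path_space :: "(nat \<Rightarrow> int) measure" where
  "path_space \<equiv> PiM UNIV (\<lambda>_. count_space UNIV)"

text \<open>
  The law of \<open>X n\<close> given \<open>X 0, \<dots>, X (n - 1)\<close>, as required by the Ionescu-Tulcea construction.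
\<close>

definition chain_kernel :: "(int \<Rightarrow> int pmf) \<Rightarrow> int \<Rightarrow> nat \<Rightarrow> (nat \<Rightarrow> int) \<Rightarrow> int measure" where
  "chain_kernel \<omega> x n X = measure_pmf
     (case n of 0 \<Rightarrow> return_pmf x | Suc m \<Rightarrow> map_pmf (\<lambda>d. X m + d) (\<omega> (X m)))"

lemma measurable_chain_kernel:
  "chain_kernel \<omega> x n \<in>
     measurable (PiM {0..<n} (\<lambda>_. count_space UNIV)) (subprob_algebra (count_space UNIV))"
proof (cases n)
  case 0
  then show ?thesis
    by (auto simp: chain_kernel_def[abs_def] space_subprob_algebra
          measure_pmf.subprob_space_axioms intro!: measurable_const)
next
  case (Suc m)
  let ?K = "\<lambda>a. measure_pmf (map_pmf (\<lambda>d. a + d) (\<omega> a))"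
  have "?K \<in> measurable (count_space UNIV) (subprob_algebra (count_space UNIV))"
    by (simp add: space_subprob_algebra measure_pmf.subprob_space_axioms)
  moreover have "(\<lambda>X. X m) \<in> measurable (PiM {0..<n} (\<lambda>_. count_space UNIV)) (count_space UNIV)"
    using Suc by (intro measurable_component_singleton) auto
  ultimately have "(\<lambda>X. ?K (X m)) \<in>
      measurable (PiM {0..<n} (\<lambda>_. count_space UNIV)) (subprob_algebra (count_space UNIV))"
    by (rule measurable_compose[rotated])
  moreover have "chain_kernel \<omega> x n = (\<lambda>X. ?K (X m))"
    by (simp add: Suc chain_kernel_def fun_eq_iff)
  ultimately show ?thesis
    by metis
qed

interpretation chain: Ionescu_Tulcea "chain_kernel \<omega> x" "\<lambda>_. count_space UNIV" for \<omega> x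
  by (rule Ionescu_Tulcea.intro[OF measurable_chain_kernel])
     (simp add: chain_kernel_def measure_pmf.prob_space_axioms)

definition quenched :: "(int \<Rightarrow> int pmf) \<Rightarrow> int \<Rightarrow> (nat \<Rightarrow> int) measure" where
  "quenched \<omega> x = chain.PF.lim \<omega> x"

definition annealed :: "(int \<Rightarrow> int pmf) measure \<Rightarrow> int \<Rightarrow> ((int \<Rightarrow> int pmf) \<times> (nat \<Rightarrow> int)) measure"
  where "annealed P x =
    P \<bind> (\<lambda>\<omega>. distr (quenched \<omega> x) (env_space \<Otimes>\<^sub>M path_space) (\<lambda>X. (\<omega>, X)))"

definition irreducible_chain :: "(int \<Rightarrow> int pmf) \<Rightarrow> bool" where
  "irreducible_chain \<omega> \<longleftrightarrow> (\<forall>a b. \<exists>n. measure (quenched \<omega> a) {X. X n = b} > 0)"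

text \<open>Both of the following may be infinite; the infimum of the empty set in \<open>enat\<close> is \<open>\<infinity>\<close>.\<close>

definition hit_ge :: "int \<Rightarrow> (nat \<Rightarrow> int) \<Rightarrow> enat" where
  "hit_ge x X = (INF n\<in>{n. x \<le> X n}. enat n)"

definition visits :: "int \<Rightarrow> (nat \<Rightarrow> int) \<Rightarrow> ennreal" where
  "visits x X = emeasure (count_space UNIV) {n. X n = x}"


section \<open>Characterisation of the quenched law\<close>

lemma space_path_space [simp]: "space path_space = UNIV"
  by (simp add: space_PiM)

lemma sets_quenched [simp, measurable_cong]: "sets (quenched \<omega> x) = sets path_space"
  by (simp add: quenched_def)

lemma space_quenched [simp]: "space (quenched \<omega> x) = UNIV"
  by (simp add: quenched_def space_PiM)

lemma PiM_count_space_finite: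
  "finite I \<Longrightarrow> PiM I (\<lambda>_. count_space (UNIV :: int set)) = count_space (PiE I (\<lambda>_. UNIV))"
  by (rule count_space_PiM_finite) auto

lemma chain_kernel_restrict:
  assumes "i \<le> n"
  shows "chain_kernel \<omega> x i (restrict w {0..<n}) = chain_kernel \<omega> x i w"
  using assms by (cases i) (simp_all add: chain_kernel_def)

lemma fun_upd_vimage_singleton:
  assumes "w \<in> PiE {0..<Suc n} (\<lambda>_. UNIV)" "X \<in> PiE {0..<n} (\<lambda>_. UNIV)"
  shows "fun_upd X n -` {w} = (if X = restrict w {0..<n} then {w n} else {})"
proof -
  have "fun_upd X n y = w \<longleftrightarrow> X = restrict w {0..<n} \<and> y = w n" for y
  proof
    assume eq: "fun_upd X n y = w"
    have "X i = restrict w {0..<n} i" for i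
      unfolding eq[symmetric] by (cases "i < n") (simp_all add: PiE_arb[OF assms(2)])
    then have "X = restrict w {0..<n}"
      by (rule ext)
    moreover have "y = w n"
      unfolding eq[symmetric] by simp
    ultimately show "X = restrict w {0..<n} \<and> y = w n" ..
  next
    assume *: "X = restrict w {0..<n} \<and> y = w n"
    have "fun_upd X n y i = w i" for i
    proof -
      consider "i < n" | "i = n" | "i > n" by linarith
      then show ?thesis
        by cases (simp_all add: * PiE_arb[OF assms(1)])
    qed
    then show "fun_upd X n y = w" by (rule ext)
  qed
  then have "y \<in> fun_upd X n -` {w} \<longleftrightarrow> y \<in> (if X = restrict w {0..<n} then {w n} else {})" for y
    by (cases "X = restrict w {0..<n}") (simp_all only: vimage_eq if_True if_False singleton_iff empty_iff simp_thms)
  then show ?thesis by blast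
qed

lemma emeasure_chain_C_singleton:
  assumes "w \<in> PiE {0..<n} (\<lambda>_. UNIV)"
  shows "emeasure (chain.C \<omega> x 0 n (\<lambda>_. undefined)) {w} =
           (\<Prod>i<n. emeasure (chain_kernel \<omega> x i w) {w i})"
  using assms
proof (induction n arbitrary: w)
  case 0
  then show ?case
    by (auto simp: PiM_count_space_finite)
next
  case (Suc n)
  define C where "C = chain.C \<omega> x 0 n (\<lambda>_. undefined)"
  define p where "p = emeasure (chain_kernel \<omega> x n w) {w n}"
  let ?w = "restrict w {0..<n}"
  let ?M = "\<lambda>n::nat. PiM {0..<n} (\<lambda>_. count_space (UNIV :: int set))"
  have u: "(\<lambda>_::nat. undefined) \<in> space (?M 0)"
    by (simp add: space_PiM)
  have sets_C: "sets C = sets (?M n)"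
    unfolding C_def by (subst chain.sets_C[OF u]) simp
  have C_ne: "space C \<noteq> {}"
    unfolding C_def by (rule prob_space.not_empty[OF chain.prob_space_C[OF u]])
  have sets_w: "{w} \<in> sets (?M (Suc n))"
    using Suc.prems by (subst PiM_count_space_finite) auto
  have sets_w': "{?w} \<in> sets C"
    unfolding sets_C by (subst PiM_count_space_finite) auto
  have eP: "chain.eP \<omega> x n \<in> measurable C (subprob_algebra (?M (Suc n)))"
    unfolding measurable_cong_sets[OF sets_C refl] by (rule chain.measurable_eP)
  have "emeasure (chain.C \<omega> x 0 (Suc n) (\<lambda>_. undefined)) {w} = emeasure (C \<bind> chain.eP \<omega> x n) {w}"
    by (simp add: C_def)
  also have "\<dots> = (\<integral>\<^sup>+X. emeasure (chain.eP \<omega> x n X) {w} \<partial>C)"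
    by (rule emeasure_bind[OF C_ne eP sets_w])
  also have "\<dots> = (\<integral>\<^sup>+X. p * indicator {?w} X \<partial>C)"
  proof (rule nn_integral_cong)
    fix X assume "X \<in> space C"
    then have X: "X \<in> space (?M n)"
      using sets_eq_imp_space_eq[OF sets_C] by simp
    then have "X \<in> PiE {0..<n} (\<lambda>_. UNIV)"
      by (simp add: space_PiM)
    note upd = fun_upd_vimage_singleton[OF Suc.prems this]
    have "emeasure (chain.eP \<omega> x n X) {w} = emeasure (chain_kernel \<omega> x n X) (fun_upd X n -` {w})"
      by (subst chain.emeasure_eP[OF X sets_w]) simp
    also have "\<dots> = p * indicator {?w} X"
      unfolding upd p_def by (simp add: chain_kernel_restrict)
    finally show "emeasure (chain.eP \<omega> x n X) {w} = p * indicator {?w} X" .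
  qed
  also have "\<dots> = p * emeasure C {?w}"
    using sets_w' by (rule nn_integral_cmult_indicator)
  also have "emeasure C {?w} = (\<Prod>i<n. emeasure (chain_kernel \<omega> x i ?w) {?w i})"
    unfolding C_def by (rule Suc.IH, rule PiE_I) simp_all
  also have "\<dots> = (\<Prod>i<n. emeasure (chain_kernel \<omega> x i w) {w i})"
    by (intro prod.cong refl) (simp add: chain_kernel_restrict)
  finally show ?case
    by (simp add: p_def mult.commute)
qed

lemma prob_space_quenched: "prob_space (quenched \<omega> x)"
proof
  have "emeasure (quenched \<omega> x) (prod_emb UNIV (\<lambda>_. count_space UNIV) {}
          (space (PiM {} (\<lambda>_. count_space UNIV)))) = 1"
    unfolding quenched_def
    using prob_space.emeasure_space_1[OF chain.PF.prob_space_P[of "{}" \<omega> x]]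
    by (subst chain.lim) (simp_all add: chain.PF.space_P)
  then show "emeasure (quenched \<omega> x) (space (quenched \<omega> x)) = 1"
    by (simp add: prod_emb_def space_PiM vimage_def restrict_def)
qed

lemma emeasure_quenched_cylinder:
  "emeasure (quenched \<omega> x) {X. \<forall>i<n. X i = w i} = (\<Prod>i<n. emeasure (chain_kernel \<omega> x i w) {w i})"
proof -
  let ?w = "restrict w {0..<n}"
  have w: "{?w} \<in> sets (PiM {0..<n} (\<lambda>_. count_space UNIV))"
    by (subst PiM_count_space_finite) auto
  have emb: "prod_emb UNIV (\<lambda>_. count_space UNIV) {0..<n} {?w} = {X. \<forall>i<n. X i = w i}"
    by (auto simp: prod_emb_def fun_eq_iff) (metis atLeastLessThan_iff le0 restrict_apply')
  have "emeasure (quenched \<omega> x) {X. \<forall>i<n. X i = w i} = emeasure (chain.CI \<omega> x {0..<n}) {?w}"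
    unfolding quenched_def emb[symmetric] using w by (intro chain.lim) auto
  also have "\<dots> = emeasure (chain.C \<omega> x 0 n (\<lambda>_. undefined)) {?w}"
    using w by (subst chain.emeasure_CI[where n = n]) (auto simp: prod_emb_id space_PiM)
  also have "\<dots> = (\<Prod>i<n. emeasure (chain_kernel \<omega> x i ?w) {?w i})"
    by (rule emeasure_chain_C_singleton) auto
  also have "\<dots> = (\<Prod>i<n. emeasure (chain_kernel \<omega> x i w) {w i})"
    by (intro prod.cong refl) (auto simp: chain_kernel_def split: nat.splits)
  finally show ?thesis .
qed

lemma emeasure_chain_kernel_0: "emeasure (chain_kernel \<omega> x 0 X) {b} = indicator {x} b"
  by (simp add: chain_kernel_def emeasure_pmf_single indicator_def)

lemma emeasure_chain_kernel_Suc: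
  "emeasure (chain_kernel \<omega> x (Suc n) X) {b} = ennreal (trans_prob \<omega> (X n) b)"
proof -
  have "pmf (map_pmf (\<lambda>d. X n + d) (\<omega> (X n))) (X n + (b - X n)) = pmf (\<omega> (X n)) (b - X n)"
    by (rule pmf_map_inj') (simp add: inj_def)
  then show ?thesis
    by (simp add: chain_kernel_def trans_prob_def emeasure_pmf_single)
qed

lemma quenched_start: "emeasure (quenched \<omega> x) {X. X 0 = x} = 1"
  using emeasure_quenched_cylinder[of \<omega> x 1 "\<lambda>_. x"] by (simp add: emeasure_chain_kernel_0)

lemma quenched_markov:
  "measure (quenched \<omega> x) {X. (\<forall>i\<le>n. X i = w i) \<and> X (Suc n) = b} =
     measure (quenched \<omega> x) {X. \<forall>i\<le>n. X i = w i} * trans_prob \<omega> (w n) b"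
proof -
  let ?w = "w(Suc n := b)"
  have "emeasure (quenched \<omega> x) {X. (\<forall>i\<le>n. X i = w i) \<and> X (Suc n) = b}
          = emeasure (quenched \<omega> x) {X. \<forall>i<Suc (Suc n). X i = ?w i}"
    by (intro arg_cong[where f = "emeasure _"]) (auto simp: less_Suc_eq_le le_Suc_eq)
  also have "\<dots> = (\<Prod>i<Suc n. emeasure (chain_kernel \<omega> x i ?w) {?w i}) *
                   ennreal (trans_prob \<omega> (w n) b)"
    unfolding emeasure_quenched_cylinder
    by (subst prod.lessThan_Suc) (simp add: emeasure_chain_kernel_Suc)
  also have "(\<Prod>i<Suc n. emeasure (chain_kernel \<omega> x i ?w) {?w i})
          = (\<Prod>i<Suc n. emeasure (chain_kernel \<omega> x i w) {w i})"
    by (intro prod.cong refl) (auto simp: chain_kernel_def split: nat.splits)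
  also have "\<dots> = emeasure (quenched \<omega> x) {X. \<forall>i\<le>n. X i = w i}"
    unfolding emeasure_quenched_cylinder[symmetric] by (simp add: less_Suc_eq_le)
  finally show ?thesis
    by (simp add: measure_def enn2real_mult trans_prob_def)
qed


section \<open>Measurability, and characterisation of the annealed law\<close>

lemma space_borel_of [simp]: "space (borel_of T) = topspace T"
  by (simp add: borel_of_def space_measure_of_conv)

lemma sets_borel_of: "sets (borel_of T) = sigma_sets (topspace T) {U. openin T U}"
  using openin_subset by (auto simp: borel_of_def intro!: sets_measure_of)

lemma openin_sets_borel_of: "openin T U \<Longrightarrow> U \<in> sets (borel_of T)"
  by (auto simp: sets_borel_of)

lemma continuous_map_measurable:
  assumes "continuous_map S T f"
  shows "f \<in> measurable (borel_of S) (borel_of T)"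
proof (rule measurable_sigma_sets[OF sets_borel_of])
  show "{U. openin T U} \<subseteq> Pow (topspace T)"
    using openin_subset by auto
  show "f \<in> space (borel_of S) \<rightarrow> topspace T"
    using continuous_map_image_subset_topspace[OF assms] by auto
  show "f -` U \<inter> space (borel_of S) \<in> sets (borel_of S)" if "U \<in> {U. openin T U}" for U
  proof -
    have "f -` U \<inter> space (borel_of S) = {x \<in> topspace S. f x \<in> U}"
      by auto
    with assms that show ?thesis
      by (auto intro!: openin_sets_borel_of simp: continuous_map_def)
  qed
qed

lemma topspace_weak_topology [simp]: "topspace weak_topology = UNIV"
proof -
  have "p \<in> topspace weak_topology" for p
  proof -
    let ?U = "{p. measure_pmf.expectation p (\<lambda>_::int. 0 :: real) \<in> UNIV}"
    have "openin weak_topology ?U"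
      unfolding weak_topology_def
      by (rule topology_generated_by_Basis, rule CollectI, intro exI conjI, rule refl)
         (auto simp: bounded_iff)
    then show ?thesis
      using openin_subset by fastforce
  qed
  then show ?thesis by auto
qed

lemma topspace_env_topology [simp]: "topspace env_topology = UNIV"
  by (simp add: env_topology_def)

lemma measurable_env_component [measurable]: "(\<lambda>\<omega>. \<omega> a) \<in> measurable env_space law_space"
  unfolding env_topology_def
  by (intro continuous_map_measurable continuous_map_product_projection) auto

lemma measurable_pmf_law_space [measurable]: "(\<lambda>p. pmf p y) \<in> borel_measurable law_space"
proof (rule borel_measurableI)
  fix U :: "real set" assume "open U"
  moreover have "bounded (range (indicator {y} :: int \<Rightarrow> real))"
    by (rule boundedI[of _ 1]) (auto simp: indicator_def)
  moreover have "(\<lambda>p. pmf p y) -` U = {p. measure_pmf.expectation p (indicator {y}) \<in> U}"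
    by (auto simp: pmf.rep_eq)
  ultimately have "openin weak_topology ((\<lambda>p. pmf p y) -` U)"
    unfolding weak_topology_def by (intro topology_generated_by_Basis) blast
  then show "(\<lambda>p. pmf p y) -` U \<inter> space law_space \<in> sets law_space"
    by (simp add: openin_sets_borel_of)
qed

lemma measurable_trans_prob [measurable]:
  "(\<lambda>\<omega>. trans_prob \<omega> a b) \<in> borel_measurable env_space"
  unfolding trans_prob_def by measurable

lemma measurable_quenched [measurable]:
  "(\<lambda>\<omega>. quenched \<omega> x) \<in> measurable env_space (prob_algebra path_space)"
proof (rule measurable_prob_algebra_generated[OF sets_PiM Int_stable_prod_algebra prod_algebra_sets_into_space])
  fix A assume "A \<in> prod_algebra UNIV (\<lambda>_::nat. count_space (UNIV :: int set))"
  then obtain J E where A: "A = prod_emb UNIV (\<lambda>_. count_space UNIV) J (PiE J E)" and J: "finite J"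
    by (rule prod_algebraE) blast
  obtain n where n: "J \<subseteq> {0..<n}"
    using J by (metis atLeast0LessThan finite_nat_iff_bounded)
  let ?B = "prod_emb {0..<n} (\<lambda>_. count_space UNIV) J (PiE J E)"
  let ?u = "\<lambda>_::nat. undefined :: int"
  have u: "?u \<in> space (PiM {0..<0} (\<lambda>_. count_space UNIV))"
    by (simp add: space_PiM)
  have sets_E: "PiE J E \<in> sets (PiM J (\<lambda>_. count_space UNIV))"
    using J by (auto intro: sets_PiM_I_finite)
  have B: "?B \<subseteq> PiE {0..<n} (\<lambda>_. UNIV)"
    by (auto simp: prod_emb_def)
  have cB: "countable ?B"
    by (rule countable_subset[OF B countable_PiE]) auto
  have "emeasure (quenched \<omega> x) A
      = (\<integral>\<^sup>+w. (\<Prod>i<n. emeasure (chain_kernel \<omega> x i w) {w i}) \<partial>count_space ?B)" for \<omega>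
  proof -
    have "emeasure (quenched \<omega> x) A = emeasure (chain.CI \<omega> x J) (PiE J E)"
      unfolding A quenched_def by (intro chain.lim J sets_E)
    also have "\<dots> = emeasure (chain.C \<omega> x 0 n ?u) ?B"
      by (rule chain.emeasure_CI[OF n sets_E])
    also have "\<dots> = (\<integral>\<^sup>+w. emeasure (chain.C \<omega> x 0 n ?u) {w} \<partial>count_space ?B)"
      using B cB
      by (intro emeasure_countable_singleton)
         (auto simp: chain.sets_C[OF u] PiM_count_space_finite)
    also have "\<dots> = (\<integral>\<^sup>+w. (\<Prod>i<n. emeasure (chain_kernel \<omega> x i w) {w i}) \<partial>count_space ?B)"
      using B by (intro nn_integral_cong emeasure_chain_C_singleton) auto
    finally show ?thesis .
  qed
  moreover have "(\<lambda>\<omega>. emeasure (chain_kernel \<omega> x i w) {b}) \<in> borel_measurable env_space" for i w b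
    by (cases i) (simp_all add: emeasure_chain_kernel_0 emeasure_chain_kernel_Suc)
  then have prod: "(\<lambda>\<omega>. \<Prod>i<n. emeasure (chain_kernel \<omega> x i w) {w i})
      \<in> borel_measurable env_space" for w
    by (intro borel_measurable_prod_ennreal)
  have "(\<lambda>z. (\<lambda>w z. \<Prod>i<n. emeasure (chain_kernel (fst z) x i w) {w i}) (snd z) z)
      \<in> borel_measurable (env_space \<Otimes>\<^sub>M count_space ?B)"
    by (rule measurable_compose_countable'[OF _ measurable_snd cB])
       (rule measurable_compose[OF measurable_fst prod])
  then have "(\<lambda>\<omega>. \<integral>\<^sup>+w. (\<Prod>i<n. emeasure (chain_kernel \<omega> x i w) {w i}) \<partial>count_space ?B)
               \<in> borel_measurable env_space"
    by (intro sigma_finite_measure.borel_measurable_nn_integral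
          sigma_finite_measure_count_space_countable cB) (simp add: split_beta)
  ultimately show "(\<lambda>\<omega>. emeasure (quenched \<omega> x) A) \<in> borel_measurable env_space"
    by simp
qed (simp_all add: prob_space_quenched)

lemma measurable_annealed_kernel [measurable]:
  "(\<lambda>\<omega>. distr (quenched \<omega> x) (env_space \<Otimes>\<^sub>M path_space) (\<lambda>X. (\<omega>, X)))
     \<in> measurable env_space (prob_algebra (env_space \<Otimes>\<^sub>M path_space))"
  by (rule measurable_distr_prob_space2[OF measurable_quenched]) simp

lemma
  assumes "prob_space P" "sets P = sets env_space"
  shows prob_space_annealed: "prob_space (annealed P x)"
    and sets_annealed: "sets (annealed P x) = sets (env_space \<Otimes>\<^sub>M path_space)"
    and emeasure_annealed_Times:
      "\<lbrakk>A \<in> sets env_space; B \<in> sets path_space\<rbrakk> \<Longrightarrow>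
         emeasure (annealed P x) (A \<times> B) = (\<integral>\<^sup>+\<omega>\<in>A. emeasure (quenched \<omega> x) B \<partial>P)"
    and nn_integral_annealed:
      "f \<in> borel_measurable (env_space \<Otimes>\<^sub>M path_space) \<Longrightarrow>
         (\<integral>\<^sup>+z. f z \<partial>annealed P x) = (\<integral>\<^sup>+\<omega>. \<integral>\<^sup>+X. f (\<omega>, X) \<partial>quenched \<omega> x \<partial>P)"
proof -
  have P: "P \<in> space (prob_algebra env_space)"
    using assms by (simp add: space_prob_algebra)
  show "prob_space (annealed P x)" "sets (annealed P x) = sets (env_space \<Otimes>\<^sub>M path_space)"
    unfolding annealed_def
    by (rule prob_space_bind'[OF P measurable_annealed_kernel],
        rule sets_bind'[OF P measurable_annealed_kernel])
  have [measurable]: "(\<lambda>X. (\<omega>, X)) \<in> measurable (quenched \<omega> x) (env_space \<Otimes>\<^sub>M path_space)" for \<omega>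
    by (subst measurable_cong_sets[OF sets_quenched refl]) (simp add: measurable_Pair1')
  show *: "(\<integral>\<^sup>+z. f z \<partial>annealed P x) = (\<integral>\<^sup>+\<omega>. \<integral>\<^sup>+X. f (\<omega>, X) \<partial>quenched \<omega> x \<partial>P)"
    if f: "f \<in> borel_measurable (env_space \<Otimes>\<^sub>M path_space)" for f
    unfolding annealed_def
    by (subst nn_integral_bind[OF f])
       (use assms(2) f in \<open>auto intro!: nn_integral_cong nn_integral_distr
          measurable_prob_algebraD[OF measurable_annealed_kernel]
          simp: measurable_cong_sets[OF assms(2) refl]\<close>)
  assume AB: "A \<in> sets env_space" "B \<in> sets path_space"
  then have "emeasure (annealed P x) (A \<times> B) = (\<integral>\<^sup>+z. indicator (A \<times> B) z \<partial>annealed P x)"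
    using \<open>sets (annealed P x) = _\<close> by (subst nn_integral_indicator) auto
  also have "\<dots> = (\<integral>\<^sup>+\<omega>. \<integral>\<^sup>+X. indicator (A \<times> B) (\<omega>, X) \<partial>quenched \<omega> x \<partial>P)"
    using AB by (intro *) auto
  also have "\<dots> = (\<integral>\<^sup>+\<omega>\<in>A. emeasure (quenched \<omega> x) B \<partial>P)"
    using AB by (intro nn_integral_cong)
      (auto simp: indicator_times nn_integral_cmult mult.commute)
  finally show "emeasure (annealed P x) (A \<times> B) = (\<integral>\<^sup>+\<omega>\<in>A. emeasure (quenched \<omega> x) B \<partial>P)" .
qed

lemma measurable_hit_ge [measurable]: "hit_ge x \<in> measurable path_space (count_space UNIV)"
proof -
  have "hit_ge x = (\<lambda>X. INF n. if x \<le> X n then enat n else \<top>)"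
  proof
    fix X
    have "hit_ge x X \<le> (if x \<le> X n then enat n else \<top>)" for n
      by (auto simp: hit_ge_def intro: INF_lower)
    moreover have "(INF n. if x \<le> X n then enat n else \<top>) \<le> enat n" if "x \<le> X n" for n
      using that by (intro INF_lower2[of n]) auto
    ultimately show "hit_ge x X = (INF n. if x \<le> X n then enat n else \<top>)"
      unfolding hit_ge_def by (intro antisym INF_greatest) auto
  qed
  also have "\<dots> \<in> measurable path_space (count_space UNIV)"
    by (intro measurable_INF) simp_all
  finally show ?thesis .
qed

lemma measurable_visits [measurable]: "visits x \<in> borel_measurable path_space"
proof -
  have "visits x = (\<lambda>X. \<Sum>n. indicator {X. X n = x} X)"
    by (auto simp: visits_def fun_eq_iff nn_integral_count_space_nat[symmetric]
        nn_integral_indicator[symmetric] indicator_def simp del: nn_integral_indicator)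
  then show ?thesis
    by simp
qed

end

theory Submission
  imports Defs
begin

text \<open>
  Let \<open>f x\<close> be the quenched expected time spent in \<open>C\<close> before hitting \<open>D\<close>, started from \<open>x\<close>; both
  \<open>N\<^sub>0\<close> and hitting times are of this form.  If \<open>f 0\<close> has finite mean, then translation invariance and the
  strong Markov property at the first visit to \<open>k\<close> bound the mean contribution of every site
  \<open>k\<close>, and Fatou's lemma excludes \<open>v \<le> 0\<close>.

  Conversely, if \<open>v > 0\<close>, averaging over the sites and reverse Fatou bound the contribution of a site to
  a walk started far to its left.  That walk enters the last \<open>R\<close> sites on the left of the target, but
  where it enters may be correlated with \<open>f\<close>.  So it suffices to show
  \<open>E (f 0) \<le> const * E (min f over W)\<close> for some finite \<open>W\<close> containing these \<open>R\<close> sites.  Starting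
  with \<open>{0}\<close>, sites are added to \<open>W\<close> one by one.  If \<open>a\<close> leads to some \<open>x\<close> in \<open>W\<close> in one step with
  positive annealed probability, let \<open>\<psi>\<close> be the minimum over \<open>W\<close> of the same expectation for the
  walk killed at \<open>a\<close>.  Then \<open>min f over W\<close> is at most \<open>\<psi>\<close> plus the minimum over \<open>W \<union> {a}\<close>, the latter
  is at least \<open>\<omega>(a, x) * \<psi>\<close>, and \<open>\<psi>\<close> is independent of the jump law at \<open>a\<close>, which yields the
  factor \<open>1 + 1 / E (\<omega>(a, x))\<close>.
\<close>

section \<open>The quenched law by first steps\<close>

text \<open>Prefixes are encoded as words so that a first step of the walk removes the head of the
  word.\<close>

definition cylinder :: "int list \<Rightarrow> (nat \<Rightarrow> int) set" where
  "cylinder ws = {X. \<forall>i<length ws. X i = ws ! i}"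

lemma cylinder_Int:
  assumes "length us \<le> length vs"
  shows "cylinder us \<inter> cylinder vs = (if \<forall>i<length us. us ! i = vs ! i then cylinder vs else {})"
  using assms by (auto simp: cylinder_def)

text \<open>Two prefixes are either comparable or contradictory, and the contradictory ones force
  \<open>{}\<close> into the family.\<close>

lemma Int_stable_cylinders: "Int_stable (insert {} (range cylinder))"
proof -
  have "cylinder us \<inter> cylinder vs \<in> insert {} (range cylinder)" for us vs
    using cylinder_Int[of us vs] cylinder_Int[of vs us]
    by (cases "length us \<le> length vs") (auto simp: Int_commute split: if_splits)
  then show ?thesis
    by (auto simp: Int_stable_def)
qed

text \<open>An event about \<open>X i\<close> is a union of cylinders over words of length
  \<open>Suc i\<close>, and there are only countably many words.\<close>

lemma sets_path_space_eq_cylinders: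
  "sets path_space = sigma_sets UNIV (insert {} (range cylinder))"
proof
  have "{X. X i \<in> A} \<in> sigma_sets UNIV (insert {} (range cylinder))" for i A
  proof -
    have "{X. X i \<in> A} = \<Union>(cylinder ` {ws. length ws = Suc i \<and> ws ! i \<in> A})"
    proof (intro set_eqI iffI)
      fix X :: "nat \<Rightarrow> int" assume "X \<in> {X. X i \<in> A}"
      then show "X \<in> \<Union>(cylinder ` {ws. length ws = Suc i \<and> ws ! i \<in> A})"
        by (intro UN_I[of "map X [0..<Suc i]"]) (auto simp: cylinder_def nth_append less_Suc_eq)
    qed (auto simp: cylinder_def)
    also have "\<dots> \<in> sigma_sets UNIV (insert {} (range cylinder))"
      by (rule sigma_sets_UNION) (auto intro: sigma_sets.Basic)
    finally show ?thesis .
  qed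
  then show "sets path_space \<subseteq> sigma_sets UNIV (insert {} (range cylinder))"
    unfolding sets_PiM_single by (auto intro!: sigma_sets_mono)
  have "cylinder ws \<in> sets path_space" for ws
  proof -
    have "cylinder ws = {X \<in> space path_space. \<forall>i<length ws. X i = ws ! i}"
      by (simp add: cylinder_def)
    also have "\<dots> \<in> sets path_space" by measurable
    finally show ?thesis .
  qed
  then show "sigma_sets UNIV (insert {} (range cylinder)) \<subseteq> sets path_space"
    using sets.sigma_sets_subset[of "insert {} (range cylinder)" path_space] by auto
qed

lemma cylinder_sets [measurable]: "cylinder ws \<in> sets path_space"
  unfolding sets_path_space_eq_cylinders by (auto intro: sigma_sets.Basic)

lemma emeasure_quenched_cylinder_Nil: "emeasure (quenched \<omega> x) (cylinder []) = 1"
  using prob_space.emeasure_space_1[OF prob_space_quenched[of \<omega> x]] by (simp add: cylinder_def)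

lemma emeasure_quenched_cylinder_Cons:
  "emeasure (quenched \<omega> x) (cylinder (w # ws)) =
     indicator {x} w * (\<Prod>i<length ws. ennreal (trans_prob \<omega> ((w # ws) ! i) (ws ! i)))"
proof -
  have "emeasure (quenched \<omega> x) (cylinder (w # ws)) =
      (\<Prod>i<Suc (length ws). emeasure (chain_kernel \<omega> x i ((!) (w # ws))) {(w # ws) ! i})"
    using emeasure_quenched_cylinder[of \<omega> x "Suc (length ws)" "(!) (w # ws)"]
    by (simp add: cylinder_def)
  then show ?thesis
    by (simp add: prod.lessThan_Suc_shift emeasure_chain_kernel_0 emeasure_chain_kernel_Suc
             del: prod.lessThan_Suc)
qed

text \<open>The law of the next position, whereas \<open>\<omega> x\<close> is the law of the
  increment.\<close>

definition jump :: "(int \<Rightarrow> int pmf) \<Rightarrow> int \<Rightarrow> int pmf" where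
  "jump \<omega> x = map_pmf ((+) x) (\<omega> x)"

lemma pmf_jump: "pmf (jump \<omega> x) y = trans_prob \<omega> x y"
  using pmf_map_inj'[of "(+) x" "\<omega> x" "y - x"] by (simp add: jump_def trans_prob_def inj_def)

lemma measurable_case_nat_path [measurable]:
  "case_nat x \<in> measurable path_space path_space"
  by (rule measurable_PiM_single') (auto split: nat.split)

lemma measurable_kernel_int:
  assumes "\<And>y. N y \<in> space (prob_algebra M)"
  shows "N \<in> measurable (measure_pmf p) (prob_algebra M)"
  using assms by (simp add: measurable_def)

text \<open>The Markov property at time one. Both sides are probability measures, so it suffices
  that they agree on the pi-system of cylinders. The first-step inductions below rest on it.\<close>

lemma quenched_step:
  "quenched \<omega> x = measure_pmf (jump \<omega> x) \<bind> (\<lambda>y. distr (quenched \<omega> y) path_space (case_nat x))"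
    (is "_ = ?B")
proof -
  let ?N = "\<lambda>y. distr (quenched \<omega> y) path_space (case_nat x)"
  have N: "?N y \<in> space (prob_algebra path_space)" for y
    by (auto simp: space_prob_algebra intro!: prob_space.prob_space_distr prob_space_quenched)
  then have Nm: "?N \<in> measurable (measure_pmf (jump \<omega> x)) (prob_algebra path_space)"
    by (rule measurable_kernel_int)
  have J: "measure_pmf (jump \<omega> x) \<in> space (prob_algebra (measure_pmf (jump \<omega> x)))"
    by (simp add: space_prob_algebra measure_pmf.prob_space_axioms)
  have sB: "sets ?B = sets path_space"
    by (rule sets_bind'[OF J Nm])
  have pB: "prob_space ?B"
    by (rule prob_space_bind'[OF J Nm])
  have eB: "emeasure ?B (cylinder ws) = (\<integral>\<^sup>+y. emeasure (quenched \<omega> y) (case_nat x -` cylinder ws) \<partial>jump \<omega> x)" for ws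
  proof -
    have "emeasure ?B (cylinder ws) = (\<integral>\<^sup>+y. emeasure (?N y) (cylinder ws) \<partial>jump \<omega> x)"
      by (rule emeasure_bind_prob_algebra[OF J Nm]) simp
    then show ?thesis by (simp add: emeasure_distr)
  qed
  have eq: "emeasure (quenched \<omega> x) (cylinder ws) = emeasure ?B (cylinder ws)" for ws
  proof (cases ws)
    case Nil
    then show ?thesis
      using prob_space.emeasure_space_1[OF pB] sets_eq_imp_space_eq[OF sB]
      by (simp only: emeasure_quenched_cylinder_Nil) (simp add: cylinder_def)
  next
    case (Cons w us)
    have v: "case_nat x -` cylinder ws = (if w = x then cylinder us else {})"
      by (auto simp: Cons cylinder_def nth_Cons less_Suc_eq_0_disj split: nat.split)
    show ?thesis
    proof (cases "w = x")
      case False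
      then show ?thesis
        unfolding eB v by (simp add: Cons emeasure_quenched_cylinder_Cons)
    next
      case True
      show ?thesis
      proof (cases us)
        case Nil
        then show ?thesis
          unfolding eB v using True
          by (simp add: Cons emeasure_quenched_cylinder_Cons emeasure_quenched_cylinder_Nil
                 measure_pmf.emeasure_space_1[simplified])
      next
        case us: (Cons u vs)
        have "emeasure ?B (cylinder ws) = (\<integral>\<^sup>+y. indicator {u} y *
              (\<Prod>i<length vs. ennreal (trans_prob \<omega> ((u # vs) ! i) (vs ! i))) \<partial>jump \<omega> x)"
          unfolding eB v using True
          by (auto simp: us emeasure_quenched_cylinder_Cons indicator_def intro!: nn_integral_cong)
        also have "\<dots> = ennreal (trans_prob \<omega> x u) *
              (\<Prod>i<length vs. ennreal (trans_prob \<omega> ((u # vs) ! i) (vs ! i)))"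
          by (subst nn_integral_multc) (simp_all add: emeasure_pmf_single pmf_jump)
        also have "\<dots> = emeasure (quenched \<omega> x) (cylinder ws)"
          by (simp add: Cons us emeasure_quenched_cylinder_Cons True prod.lessThan_Suc_shift
              del: prod.lessThan_Suc)
        finally show ?thesis ..
      qed
    qed
  qed
  show ?thesis
  proof (rule measure_eqI_generator_eq[OF Int_stable_cylinders])
    show "sets (quenched \<omega> x) = sigma_sets UNIV (insert {} (range cylinder))"
      "sets ?B = sigma_sets UNIV (insert {} (range cylinder))"
      by (simp_all add: sB sets_path_space_eq_cylinders)
    show "range (\<lambda>_::nat. cylinder []) \<subseteq> insert {} (range cylinder)" "(\<Union>i::nat. cylinder []) = UNIV"
      by (auto, simp add: cylinder_def)
    show "emeasure (quenched \<omega> x) (cylinder []) \<noteq> \<infinity>"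
      by (simp add: emeasure_quenched_cylinder_Nil)
    show "emeasure (quenched \<omega> x) X = emeasure ?B X" if "X \<in> insert {} (range cylinder)" for X
      using that by (elim insertE imageE; simp only: emeasure_empty eq)
  qed simp_all
qed

lemma nn_integral_quenched_step:
  assumes [measurable]: "F \<in> borel_measurable path_space"
  shows "(\<integral>\<^sup>+X. F X \<partial>quenched \<omega> x) = (\<integral>\<^sup>+y. \<integral>\<^sup>+X. F (case_nat x X) \<partial>quenched \<omega> y \<partial>jump \<omega> x)"
proof -
  let ?N = "\<lambda>y. distr (quenched \<omega> y) path_space (case_nat x)"
  have "?N y \<in> space (subprob_algebra path_space)" for y
    by (auto simp: space_subprob_algebra
          intro!: prob_space_imp_subprob_space prob_space.prob_space_distr prob_space_quenched)
  then have Nm: "?N \<in> measurable (measure_pmf (jump \<omega> x)) (subprob_algebra path_space)"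
    by (simp add: measurable_def)
  show ?thesis
    by (subst quenched_step, subst nn_integral_bind[OF assms Nm]) (simp add: nn_integral_distr)
qed

text \<open>
  The Borel \<open>\<sigma>\<close>-algebra of the product topology might be strictly finer than the product of the Borel
  \<open>\<sigma>\<close>-algebras.  Quenched quantities only depend on the latter, so the proof works there and
  no second countability of the weak topology is needed.
\<close>

abbreviation env_product :: "(int \<Rightarrow> int pmf) measure" where
  "env_product \<equiv> PiM UNIV (\<lambda>_. law_space)"

lemma space_env_product [simp]: "space env_product = UNIV"
  by (simp add: space_PiM)

lemma measurable_trans_prob_PiM [measurable]:
  "(\<lambda>\<omega>. trans_prob \<omega> a b) \<in> borel_measurable env_product"
  unfolding trans_prob_def by measurable

text \<open>Cylinder probabilities are finite products of transition probabilities, which are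
  measurable for the product \<sigma>-algebra.\<close>

lemma measurable_quenched_PiM [measurable]:
  "(\<lambda>\<omega>. quenched \<omega> x) \<in> measurable env_product (prob_algebra path_space)"
proof (rule measurable_prob_algebra_generated[OF sets_path_space_eq_cylinders Int_stable_cylinders])
  fix A assume "A \<in> insert {} (range cylinder)"
  then consider "A = {}" | ws where "A = cylinder ws" by auto
  then show "(\<lambda>\<omega>. emeasure (quenched \<omega> x) A) \<in> borel_measurable env_product"
  proof cases
    case 2
    show ?thesis
      unfolding 2
      by (cases ws) (simp_all add: emeasure_quenched_cylinder_Nil emeasure_quenched_cylinder_Cons)
  qed simp
qed (simp_all add: prob_space_quenched)

section \<open>Expected occupation times before absorption\<close>

text \<open>
  \<open>cnt C D n\<close> counts the times below \<open>n\<close> spent in \<open>C\<close> before the first visit to \<open>D\<close>.  As \<open>n\<close> tends to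
  infinity, \<open>C = {0}, D = {}\<close> gives the number of visits to \<open>0\<close> and \<open>C = UNIV, D = {1..}\<close> the hitting
  time of \<open>{1..}\<close>.  Cutting off in time keeps everything bounded and compatible with first steps.
\<close>

definition cnt :: "int set \<Rightarrow> int set \<Rightarrow> nat \<Rightarrow> (nat \<Rightarrow> int) \<Rightarrow> ennreal" where
  "cnt C D n X = (\<Sum>j<n. if X j \<in> C \<and> (\<forall>i\<le>j. X i \<notin> D) then 1 else 0)"

text \<open>A truncated Green function of the walk killed on entering \<open>D\<close>, summed over
  the target sites in \<open>C\<close>.\<close>

definition green :: "(int \<Rightarrow> int pmf) \<Rightarrow> int set \<Rightarrow> int set \<Rightarrow> nat \<Rightarrow> int \<Rightarrow> ennreal" where
  "green \<omega> C D n x = (\<integral>\<^sup>+X. cnt C D n X \<partial>quenched \<omega> x)"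

lemma measurable_cnt [measurable]: "cnt C D n \<in> borel_measurable path_space"
  unfolding cnt_def by measurable

lemma cnt_Suc_case_nat:
  "cnt C D (Suc n) (case_nat x X) = (if x \<in> D then 0 else indicator C x + cnt C D n X)"
proof -
  have "(\<forall>i\<le>Suc j. (case i of 0 \<Rightarrow> x | Suc m \<Rightarrow> X m) \<notin> D) \<longleftrightarrow> x \<notin> D \<and> (\<forall>i\<le>j. X i \<notin> D)" for j
    unfolding less_Suc_eq_le[symmetric] All_less_Suc2 by simp
  then show ?thesis
    by (simp add: cnt_def sum.lessThan_Suc_shift indicator_def del: sum.lessThan_Suc)
qed

lemma cnt_le: "cnt C D n X \<le> of_nat n"
proof -
  have "cnt C D n X \<le> (\<Sum>j<n. 1)"
    unfolding cnt_def by (intro sum_mono) auto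
  then show ?thesis by simp
qed

lemma cnt_mono: "m \<le> n \<Longrightarrow> cnt C D m X \<le> cnt C D n X"
  unfolding cnt_def by (intro sum_mono2) auto

lemma green_0 [simp]: "green \<omega> C D 0 x = 0"
  by (simp add: green_def cnt_def)

lemma green_Suc:
  "green \<omega> C D (Suc n) x =
     (if x \<in> D then 0 else indicator C x + (\<integral>\<^sup>+y. green \<omega> C D n y \<partial>jump \<omega> x))"
  using prob_space.emeasure_space_1[OF prob_space_quenched]
  by (auto simp: green_def nn_integral_quenched_step[OF measurable_cnt[of C D "Suc n"]]
        cnt_Suc_case_nat nn_integral_add measure_pmf.emeasure_space_1[simplified])

lemma green_mono: "m \<le> n \<Longrightarrow> green \<omega> C D m x \<le> green \<omega> C D n x"
  unfolding green_def by (intro nn_integral_mono cnt_mono)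

text \<open>A walk killed in \<open>D\<close> never jumps from there. This is the source of the
  independence in \<open>nn_integral_min_green_le\<close>.\<close>

lemma green_cong:
  assumes "\<And>b. b \<notin> D \<Longrightarrow> \<omega> b = \<omega>' b"
  shows "green \<omega> C D n x = green \<omega>' C D n x"
  using assms by (induction n arbitrary: x) (simp_all add: green_Suc jump_def)

lemma green_antimono: "D \<subseteq> D' \<Longrightarrow> green \<omega> C D' n x \<le> green \<omega> C D n x"
  unfolding green_def cnt_def by (intro nn_integral_mono sum_mono) auto

text \<open>The count is split at the first visit to \<open>a\<close>: the earlier part belongs to
  the walk killed at \<open>a\<close>, the later part to a restart at \<open>a\<close> with at most
  \<open>n\<close> steps left.\<close>

lemma green_le_insert: "green \<omega> C D n x \<le> green \<omega> C (insert a D) n x + green \<omega> C D n a"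
proof (induction n arbitrary: x)
  case (Suc n)
  show ?case
  proof (cases "x = a \<or> x \<in> D")
    case False
    have "(\<integral>\<^sup>+y. green \<omega> C D n y \<partial>jump \<omega> x) \<le>
          (\<integral>\<^sup>+y. (green \<omega> C (insert a D) n y + green \<omega> C D n a) \<partial>jump \<omega> x)"
      by (intro nn_integral_mono Suc.IH)
    also have "\<dots> = (\<integral>\<^sup>+y. green \<omega> C (insert a D) n y \<partial>jump \<omega> x) + green \<omega> C D n a"
      by (simp add: nn_integral_add measure_pmf.emeasure_space_1[simplified])
    also have "\<dots> \<le> (\<integral>\<^sup>+y. green \<omega> C (insert a D) n y \<partial>jump \<omega> x) + green \<omega> C D (Suc n) a"
      by (intro add_left_mono green_mono) simp
    finally show ?thesis
      using False by (simp add: green_Suc[of _ _ _ _ x] add.assoc add_left_mono)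
  qed (auto simp: green_Suc)
qed simp

text \<open>Only the walks whose first jump goes from \<open>a\<close> to \<open>x\<close> are kept;
  this jump uses up one unit of the horizon.\<close>

lemma green_ge_step:
  assumes "a \<notin> D"
  shows "ennreal (trans_prob \<omega> a x) * green \<omega> C D n x \<le> green \<omega> C D (Suc n) a"
proof -
  have "ennreal (trans_prob \<omega> a x) * green \<omega> C D n x =
        (\<integral>\<^sup>+y. green \<omega> C D n x * indicator {x} y \<partial>jump \<omega> a)"
    by (subst nn_integral_cmult_indicator) (simp_all add: emeasure_pmf_single pmf_jump mult.commute)
  also have "\<dots> \<le> (\<integral>\<^sup>+y. green \<omega> C D n y \<partial>jump \<omega> a)"
    by (intro nn_integral_mono) (auto simp: indicator_def)
  finally show ?thesis
    using assms by (simp add: green_Suc add_increasing)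
qed

lemma green_shift:
  "green (\<lambda>a. \<omega> (a + k)) C D n x = green \<omega> ((+) k ` C) ((+) k ` D) n (x + k)"
proof (induction n arbitrary: x)
  case (Suc n)
  have jump: "jump \<omega> (x + k) = map_pmf (\<lambda>y. y + k) (jump (\<lambda>a. \<omega> (a + k)) x)"
    by (auto simp: jump_def pmf.map_comp comp_def intro!: map_pmf_cong)
  have "x + k \<in> (+) k ` A \<longleftrightarrow> x \<in> A" for A
    by (auto simp: image_iff algebra_simps)
  then show ?case
    by (simp add: green_Suc jump Suc.IH[abs_def] indicator_def)
qed simp

lemma measurable_nn_integral_quenched [measurable]:
  assumes [measurable]: "F \<in> borel_measurable path_space"
  shows "(\<lambda>\<omega>. \<integral>\<^sup>+X. F X \<partial>quenched \<omega> x) \<in> borel_measurable env_product"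
  by (rule measurable_compose[OF measurable_prob_algebraD[OF measurable_quenched_PiM]
        nn_integral_measurable_subprob_algebra[OF assms]])

lemma measurable_green [measurable]: "(\<lambda>\<omega>. green \<omega> C D n x) \<in> borel_measurable env_product"
  unfolding green_def by measurable

section \<open>Minima over sets of starting points\<close>

definition min_green :: "(int \<Rightarrow> int pmf) \<Rightarrow> int set \<Rightarrow> int set \<Rightarrow> nat \<Rightarrow> int set \<Rightarrow> ennreal" where
  "min_green \<omega> C D n W = (INF w\<in>W. green \<omega> C D n w)"

lemma measurable_min_green [measurable]:
  "(\<lambda>\<omega>. min_green \<omega> C D n W) \<in> borel_measurable env_product"
  unfolding min_green_def by (rule borel_measurable_INF) auto

lemma min_green_mono: "m \<le> n \<Longrightarrow> min_green \<omega> C D m W \<le> min_green \<omega> C D n W"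
  unfolding min_green_def by (rule INF_mono) (use green_mono in blast)

lemma min_green_attained:
  assumes "finite W" "W \<noteq> {}"
  obtains w where "w \<in> W" "min_green \<omega> C D n W = green \<omega> C D n w"
proof -
  have "min_green \<omega> C D n W = Min (green \<omega> C D n ` W)"
    unfolding min_green_def using assms by (simp add: Min_Inf)
  also have "\<dots> \<in> green \<omega> C D n ` W"
    using assms by (intro Min_in) auto
  finally show ?thesis using that by auto
qed

lemma min_green_shift:
  "min_green (\<lambda>a. \<omega> (a + k)) C D n W = min_green \<omega> ((+) k ` C) ((+) k ` D) n ((+) k ` W)"
  by (simp add: min_green_def green_shift image_comp comp_def add.commute)

text \<open>If the minimum over \<open>insert a W\<close> is attained at \<open>a\<close>, the count
  is split at the first visit to \<open>a\<close>. Otherwise monotonicity in the horizon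
  suffices.\<close>

lemma min_green_le_insert:
  assumes "finite W" "W \<noteq> {}"
  shows "min_green \<omega> C D n W \<le> min_green \<omega> C (insert a D) n W + min_green \<omega> C D (Suc n) (insert a W)"
proof -
  \<comment> \<open>The minimiser is taken for the walk killed at \<open>a\<close>; for the original
    walk \<open>w\<close> is merely a competitor, which is the direction needed.\<close>
  obtain w where w: "w \<in> W" "min_green \<omega> C (insert a D) n W = green \<omega> C (insert a D) n w"
    using min_green_attained[OF assms] by blast
  have "min_green \<omega> C D n W \<le> green \<omega> C D n w"
    using w(1) by (auto simp: min_green_def intro: INF_lower)
  also have "\<dots> \<le> green \<omega> C (insert a D) n w + green \<omega> C D n a"
    by (rule green_le_insert)
  also have "\<dots> \<le> min_green \<omega> C (insert a D) n W + green \<omega> C D (Suc n) a"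
    unfolding w(2) by (intro add_left_mono green_mono) simp
  finally have "min_green \<omega> C D n W \<le> min_green \<omega> C (insert a D) n W + green \<omega> C D (Suc n) a" .
  moreover have "min_green \<omega> C D n W \<le> min_green \<omega> C (insert a D) n W + min_green \<omega> C D (Suc n) W"
    by (simp add: add_increasing min_green_mono)
  moreover have "min_green \<omega> C D (Suc n) (insert a W) = min (green \<omega> C D (Suc n) a) (min_green \<omega> C D (Suc n) W)"
    by (simp add: min_green_def inf_min)
  ultimately show ?thesis
    by (simp add: min_def)
qed

text \<open>From a point of \<open>W\<close>, killing at \<open>a\<close> can only lower the count
  and the factor is at most 1. From \<open>a\<close>, one jump to \<open>x\<close> reaches
  \<open>W\<close>.\<close>

lemma trans_prob_mult_min_green_le:
  assumes "x \<in> W" "a \<notin> D"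
  shows "ennreal (trans_prob \<omega> a x) * min_green \<omega> C (insert a D) n W \<le>
           min_green \<omega> C D (Suc n) (insert a W)"
proof -
  let ?m = "min_green \<omega> C (insert a D) n W" and ?t = "ennreal (trans_prob \<omega> a x)"
  have m: "?m \<le> green \<omega> C D n w" if "w \<in> W" for w
    using that unfolding min_green_def
    by (rule INF_lower2) (rule green_antimono, blast)
  have "?t \<le> 1"
    by (simp add: trans_prob_def pmf_le_1)
  then have "?t * ?m \<le> green \<omega> C D (Suc n) w" if "w \<in> W" for w
    using mult_right_mono[of ?t 1 ?m] m[OF that] green_mono[of n "Suc n" \<omega> C D w]
    by simp
  moreover have "?t * ?m \<le> green \<omega> C D (Suc n) a"
    using mult_left_mono[OF m[OF assms(1)], of ?t] green_ge_step[OF assms(2), of \<omega> x C n]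
    by simp
  ultimately show ?thesis
    unfolding min_green_def[of _ _ _ _ "insert a W"] by (intro INF_greatest) auto
qed

section \<open>Comparison of starting points in an i.i.d. environment\<close>

locale iid_environment =
  fixes \<mu> :: "int pmf measure"
  assumes prob_law: "prob_space \<mu>" and sets_law [measurable_cong]: "sets \<mu> = sets law_space"
begin

definition env :: "(int \<Rightarrow> int pmf) measure" where
  "env = PiM UNIV (\<lambda>_. \<mu>)"

lemma sets_env [simp, measurable_cong]: "sets env = sets env_product"
  unfolding env_def by (intro sets_PiM_cong refl sets_law)

lemma space_env [simp]: "space env = UNIV"
  using sets_eq_imp_space_eq[OF sets_env] by simp

sublocale env: prob_space env
  unfolding env_def by (rule prob_space_PiM) (rule prob_law)

text \<open>A translation is an injective reindexing of an i.i.d. product and so preserves its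
  law.\<close>

lemma nn_integral_shift:
  assumes [measurable]: "F \<in> borel_measurable env_product"
  shows "(\<integral>\<^sup>+\<omega>. F (\<lambda>a. \<omega> (a + k)) \<partial>env) = (\<integral>\<^sup>+\<omega>. F \<omega> \<partial>env)"
proof -
  have "env = distr env env (\<lambda>\<omega> a. \<omega> (a + k))"
    using distr_PiM_reindex[of UNIV "\<lambda>_. \<mu>" "\<lambda>a::int. a + k" UNIV] prob_law
    by (simp add: env_def restrict_def)
  then have "(\<integral>\<^sup>+\<omega>. F \<omega> \<partial>env) = (\<integral>\<^sup>+\<omega>. F \<omega> \<partial>distr env env (\<lambda>\<omega> a. \<omega> (a + k)))"
    by simp
  also have "\<dots> = (\<integral>\<^sup>+\<omega>. F (\<lambda>a. \<omega> (a + k)) \<partial>env)"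
    by (rule nn_integral_distr)
       (auto intro!: measurable_PiM_single' simp: measurable_cong_sets[OF sets_env sets_env])
  finally show ?thesis ..
qed

text \<open>Overwriting one coordinate by an independent copy preserves the product law, and Fubini
  then isolates the site \<open>a\<close>.\<close>

lemma nn_integral_resample:
  assumes F: "F \<in> borel_measurable env_product"
  shows "(\<integral>\<^sup>+\<omega>. F \<omega> \<partial>env) = (\<integral>\<^sup>+p. \<integral>\<^sup>+\<omega>. F (fun_upd \<omega> a p) \<partial>env \<partial>\<mu>)"
proof -
  have eq: "distr (\<mu> \<Otimes>\<^sub>M env) env (\<lambda>(p, \<omega>). fun_upd \<omega> a p) = env"
    using distr_pair_PiM_eq_PiM[of UNIV "\<lambda>_. \<mu>" a] prob_law by (simp add: env_def)
  have F': "F \<in> borel_measurable env"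
    using F by simp
  have m: "(\<lambda>(p, \<omega>). fun_upd \<omega> a p) \<in> measurable (\<mu> \<Otimes>\<^sub>M env) env"
    unfolding env_def split_beta'
    by (rule measurable_fun_upd[where J = UNIV]) auto
  have "(\<integral>\<^sup>+\<omega>. F \<omega> \<partial>env) = (\<integral>\<^sup>+z. F (case z of (p, \<omega>) \<Rightarrow> fun_upd \<omega> a p) \<partial>(\<mu> \<Otimes>\<^sub>M env))"
    using nn_integral_distr[OF m, of F] F by (simp add: eq)
  also have "\<dots> = (\<integral>\<^sup>+p. \<integral>\<^sup>+\<omega>. F (fun_upd \<omega> a p) \<partial>env \<partial>\<mu>)"
    by (subst env.nn_integral_fst[symmetric]) (simp_all add: measurable_compose[OF m F'])
  finally show ?thesis .
qed

text \<open>A deterministic graph: the jumps of positive annealed probability.\<close>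

definition edge :: "(int \<times> int) set" where
  "edge = {(a, b). (\<integral>\<^sup>+\<omega>. ennreal (trans_prob \<omega> a b) \<partial>env) \<noteq> 0}"

text \<open>\<open>G\<close> ignores the coordinate at \<open>a\<close>, so after resampling that
  coordinate the inner integral is a constant factor.\<close>

lemma nn_integral_trans_prob_mult:
  assumes [measurable]: "G \<in> borel_measurable env_product"
    and G: "\<And>\<omega> p. G (fun_upd \<omega> a p) = G \<omega>"
  shows "(\<integral>\<^sup>+\<omega>. ennreal (trans_prob \<omega> a b) * G \<omega> \<partial>env) =
     (\<integral>\<^sup>+\<omega>. ennreal (trans_prob \<omega> a b) \<partial>env) * (\<integral>\<^sup>+\<omega>. G \<omega> \<partial>env)"
proof -
  have [measurable]: "(\<lambda>p. ennreal (pmf p (b - a))) \<in> borel_measurable \<mu>"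
    unfolding measurable_cong_sets[OF sets_law refl]
    by (rule measurable_compose[OF measurable_pmf_law_space measurable_ennreal])
  have 1: "(\<integral>\<^sup>+\<omega>. ennreal (trans_prob \<omega> a b) * G \<omega> \<partial>env) =
      (\<integral>\<^sup>+p. ennreal (pmf p (b - a)) * (\<integral>\<^sup>+\<omega>. G \<omega> \<partial>env) \<partial>\<mu>)"
    by (subst nn_integral_resample[where a = a]) (simp_all add: trans_prob_def G nn_integral_cmult)
  have 2: "(\<integral>\<^sup>+\<omega>. ennreal (trans_prob \<omega> a b) \<partial>env) = (\<integral>\<^sup>+p. ennreal (pmf p (b - a)) \<partial>\<mu>)"
    using prob_space.emeasure_space_1[OF env.prob_space_axioms]
    by (subst nn_integral_resample[where a = a]) (simp_all add: trans_prob_def)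
  show ?thesis
    unfolding 1 2 by (rule nn_integral_multc) measurable
qed

lemma nn_integral_min_green_le:
  assumes W: "finite W" "x \<in> W" and "a \<notin> D" and edge: "(a, x) \<in> edge"
  shows "(\<integral>\<^sup>+\<omega>. min_green \<omega> C D n W \<partial>env) \<le>
     (1 + inverse (\<integral>\<^sup>+\<omega>. ennreal (trans_prob \<omega> a x) \<partial>env)) *
       (\<integral>\<^sup>+\<omega>. min_green \<omega> C D (Suc n) (insert a W) \<partial>env)"
proof -
  define e where "e = (\<integral>\<^sup>+\<omega>. ennreal (trans_prob \<omega> a x) \<partial>env)"
  define J where "J = (\<integral>\<^sup>+\<omega>. min_green \<omega> C D (Suc n) (insert a W) \<partial>env)"
  let ?m = "\<lambda>\<omega>. min_green \<omega> C (insert a D) n W"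
  \<comment> \<open>Cancelling \<open>e\<close> in \<open>ennreal\<close> requires that it is
    neither 0 nor infinite.\<close>
  have "e \<le> (\<integral>\<^sup>+\<omega>. 1 \<partial>env)"
    unfolding e_def by (intro nn_integral_mono) (simp add: trans_prob_def pmf_le_1)
  then have "e \<le> 1"
    using env.emeasure_space_1 by simp
  then have e: "e \<noteq> 0" "e \<noteq> \<top>"
    using edge by (auto simp: edge_def e_def[symmetric] top_unique)
  \<comment> \<open>Walks are killed at \<open>a\<close> in \<open>?m\<close>, so it does not see the jump law at \<open>a\<close> and is independent of it.\<close>
  have "?m (fun_upd \<omega> a p) = ?m \<omega>" for \<omega> p
    unfolding min_green_def by (intro INF_cong refl green_cong) auto
  then have "e * (\<integral>\<^sup>+\<omega>. ?m \<omega> \<partial>env) = (\<integral>\<^sup>+\<omega>. ennreal (trans_prob \<omega> a x) * ?m \<omega> \<partial>env)"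
    unfolding e_def by (intro nn_integral_trans_prob_mult[symmetric]) auto
  also have "\<dots> \<le> J"
    unfolding J_def by (intro nn_integral_mono trans_prob_mult_min_green_le assms)
  finally have "inverse e * (e * (\<integral>\<^sup>+\<omega>. ?m \<omega> \<partial>env)) \<le> inverse e * J"
    by (rule mult_left_mono) simp
  moreover have "inverse e * e = 1"
    using e ennreal_divide_self[of e] by (simp add: divide_ennreal_def mult.commute less_top)
  then have "inverse e * (e * y) = y" for y
    by (simp add: mult.assoc[symmetric])
  ultimately have "(\<integral>\<^sup>+\<omega>. ?m \<omega> \<partial>env) \<le> inverse e * J"
    by simp
  have "(\<integral>\<^sup>+\<omega>. min_green \<omega> C D n W \<partial>env) \<le>
      (\<integral>\<^sup>+\<omega>. ?m \<omega> + min_green \<omega> C D (Suc n) (insert a W) \<partial>env)"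
    using W by (intro nn_integral_mono min_green_le_insert) auto
  also have "\<dots> = (\<integral>\<^sup>+\<omega>. ?m \<omega> \<partial>env) + J"
    unfolding J_def by (rule nn_integral_add) auto
  also have "\<dots> \<le> inverse e * J + J"
    by (intro add_right_mono) fact
  finally show ?thesis
    by (simp add: e_def J_def distrib_right add.commute)
qed

text \<open>
  The constants must not depend on \<open>n\<close>, since the bounds are later used in the limit.
  The time shift \<open>m\<close> makes room for the paths along which \<open>W\<close> is grown from \<open>{0}\<close>.
\<close>

definition dominates :: "ennreal \<Rightarrow> nat \<Rightarrow> int set \<Rightarrow> bool" where
  "dominates c m W \<longleftrightarrow> (\<forall>C D n. D \<inter> W = {} \<longrightarrow>
     (\<integral>\<^sup>+\<omega>. green \<omega> C D n 0 \<partial>env) \<le> c * (\<integral>\<^sup>+\<omega>. min_green \<omega> C D (n + m) W \<partial>env))"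

text \<open>The site 0 stays in the set so that further paths ending at 0 can be attached.\<close>

definition dominating :: "int set \<Rightarrow> bool" where
  "dominating W \<longleftrightarrow> finite W \<and> 0 \<in> W \<and> (\<exists>c m. c < \<top> \<and> dominates c m W)"

lemma dominates_insert:
  assumes W: "dominates c m W" "finite W" "x \<in> W" and edge: "(a, x) \<in> edge"
  shows "dominates (c * (1 + inverse (\<integral>\<^sup>+\<omega>. ennreal (trans_prob \<omega> a x) \<partial>env))) (Suc m) (insert a W)"
  unfolding dominates_def
proof (intro allI impI)
  fix C D n assume D: "D \<inter> insert a W = {}"
  let ?d = "1 + inverse (\<integral>\<^sup>+\<omega>. ennreal (trans_prob \<omega> a x) \<partial>env)"
  have "D \<inter> W = {}" "a \<notin> D"
    using D by auto
  then have "(\<integral>\<^sup>+\<omega>. green \<omega> C D n 0 \<partial>env) \<le> c * (\<integral>\<^sup>+\<omega>. min_green \<omega> C D (n + m) W \<partial>env)"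
    using W(1) by (simp add: dominates_def)
  also have "\<dots> \<le> c * (?d * (\<integral>\<^sup>+\<omega>. min_green \<omega> C D (Suc (n + m)) (insert a W) \<partial>env))"
    by (intro mult_left_mono nn_integral_min_green_le W edge \<open>a \<notin> D\<close>) simp
  finally show "(\<integral>\<^sup>+\<omega>. green \<omega> C D n 0 \<partial>env) \<le>
      c * ?d * (\<integral>\<^sup>+\<omega>. min_green \<omega> C D (n + Suc m) (insert a W) \<partial>env)"
    by (simp add: mult.assoc)
qed

lemma dominating_insert:
  assumes W: "dominating W" "x \<in> W" and edge: "(a, x) \<in> edge"
  shows "dominating (insert a W)"
proof -
  obtain c m where c: "finite W" "0 \<in> W" "c < \<top>" "dominates c m W"
    using W(1) by (auto simp: dominating_def)
  have "c * (1 + inverse (\<integral>\<^sup>+\<omega>. ennreal (trans_prob \<omega> a x) \<partial>env)) < \<top>"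
    using edge c(3) by (simp add: edge_def less_top[symmetric] ennreal_mult_eq_top_iff)
  then show ?thesis
    unfolding dominating_def
    using c(1,2) dominates_insert[OF c(4,1) W(2) edge] by blast
qed

text \<open>The path is attached backwards from \<open>x\<close>, so that each new site has an edge
  into the set built so far.\<close>

lemma dominating_path:
  assumes "(a, x) \<in> edge\<^sup>*" "x \<in> W" "dominating W"
  shows "\<exists>W'. dominating W' \<and> insert a W \<subseteq> W'"
  using assms(1)
proof (induction rule: converse_rtrancl_induct)
  case base
  then show ?case using assms by blast
next
  case (step a b)
  then obtain W' where W': "dominating W'" "insert b W \<subseteq> W'" by blast
  then have "dominating (insert a W')"
    using step.hyps(1) by (intro dominating_insert[of W' b]) auto
  then show ?case using W'(2) by (intro exI[of _ "insert a W'"]) auto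
qed

text \<open>For \<open>{0}\<close> the comparison is an equality with constant 1 and no time shift.
  Then a path to 0 is attached for each point of \<open>A\<close>.\<close>

lemma dominating_superset:
  assumes "finite A" "\<And>a. a \<in> A \<Longrightarrow> (a, 0) \<in> edge\<^sup>*"
  shows "\<exists>W. dominating W \<and> A \<subseteq> W"
  using assms
proof (induction A rule: finite_induct)
  case empty
  have "dominating {0}"
    unfolding dominating_def
    by (intro conjI exI[of _ "1::ennreal"] exI[of _ "0::nat"]) (simp_all add: dominates_def min_green_def)
  then show ?case by blast
next
  case (insert a A)
  then obtain W where W: "dominating W" "A \<subseteq> W" by blast
  then have "0 \<in> W" by (simp add: dominating_def)
  then obtain W' where "dominating W'" "insert a W \<subseteq> W'"
    using dominating_path[OF insert.prems[of a] _ W(1)] by auto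
  then show ?case using W(2) by (intro exI[of _ W']) auto
qed

end

section \<open>The strong Markov property at hitting times\<close>

text \<open>Pairs of integers form a countable discrete space, on which every function is
  measurable.\<close>

lemma measurable_path_pair:
  assumes "\<And>a b. f a b \<in> space N"
  shows "(\<lambda>X. f (X m) (X n)) \<in> measurable path_space N"
proof -
  have "(\<lambda>X. (X m, X n)) \<in> measurable path_space (count_space UNIV \<Otimes>\<^sub>M count_space UNIV)"
    by measurable
  then have "(\<lambda>X. (X m, X n)) \<in> measurable path_space (count_space UNIV)"
    by (simp add: pair_measure_countable)
  from measurable_compose[OF this, of "\<lambda>(a, b). f a b" N] assms show ?thesis by auto
qed

text \<open>At most one summand is nonzero: the value is \<open>F\<close> of the path restarted at
  its first visit to \<open>A\<close>, and 0 if there is none. The series gives measurability and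
  allows induction on the hitting time.\<close>

definition after_hit :: "int set \<Rightarrow> ((nat \<Rightarrow> int) \<Rightarrow> ennreal) \<Rightarrow> (nat \<Rightarrow> int) \<Rightarrow> ennreal" where
  "after_hit A F X = (\<Sum>n. if X n \<in> A \<and> (\<forall>i<n. X i \<notin> A) then F (\<lambda>j. X (n + j)) else 0)"

lemma after_hit_first:
  assumes "X m \<in> A" "\<And>i. i < m \<Longrightarrow> X i \<notin> A"
  shows "after_hit A F X = F (\<lambda>j. X (m + j))"
proof -
  have "X n \<in> A \<and> (\<forall>i<n. X i \<notin> A) \<longleftrightarrow> n = m" for n
    using assms by (cases n m rule: linorder_cases) auto
  then show ?thesis
    unfolding after_hit_def by (subst suminf_finite[of "{m}"]) auto
qed

lemma after_hit_never: "(\<And>n. X n \<notin> A) \<Longrightarrow> after_hit A F X = 0"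
  by (simp add: after_hit_def)

lemma first_hit_cases:
  fixes X :: "nat \<Rightarrow> int"
  obtains (never) "\<And>n. X n \<notin> A" | (hit) m where "X m \<in> A" "\<And>i. i < m \<Longrightarrow> X i \<notin> A"
proof (cases "\<exists>n. X n \<in> A")
  case True
  show ?thesis
    using LeastI_ex[OF True] not_less_Least[of _ "\<lambda>n. X n \<in> A"] by (rule hit)
qed (use never in blast)

lemma measurable_path_shift [measurable]: "(\<lambda>X j. X (n + j)) \<in> measurable path_space path_space"
  by (rule measurable_PiM_single') auto

lemma measurable_at_first_hit:
  assumes F: "F \<in> borel_measurable path_space"
  shows "(\<lambda>X. if X n \<in> A \<and> (\<forall>i<n. X i \<notin> A) then F (\<lambda>j. X (n + j)) else (0 :: ennreal))
    \<in> borel_measurable path_space"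
proof -
  have [measurable]: "(\<lambda>X. F (\<lambda>j. X (n + j))) \<in> borel_measurable path_space"
    by (rule measurable_compose[OF measurable_path_shift F])
  show ?thesis by measurable
qed

lemma measurable_after_hit [measurable]:
  "F \<in> borel_measurable path_space \<Longrightarrow> after_hit A F \<in> borel_measurable path_space"
  unfolding after_hit_def[abs_def]
  by (intro borel_measurable_suminf_order measurable_at_first_hit)

lemma emeasure_quenched_UNIV [simp]: "emeasure (quenched \<omega> x) UNIV = 1"
  using prob_space.emeasure_space_1[OF prob_space_quenched] by simp

lemma AE_quenched_start: "AE X in quenched \<omega> x. X 0 = x"
proof -
  interpret prob_space "quenched \<omega> x" by (rule prob_space_quenched)
  have "{X \<in> space path_space. X 0 = x} \<in> sets path_space" by measurable
  then have "{X. X 0 = x} \<in> sets path_space" by simp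
  then have "AE X in quenched \<omega> x. X \<in> {X. X 0 = x}"
    by (subst AE_in_set_eq_1) (simp_all add: quenched_start measure_def)
  then show ?thesis by simp
qed

text \<open>For each fixed value \<open>n\<close> of the hitting time, the identity follows by
  induction on \<open>n\<close> with first steps; then the values of \<open>n\<close> are
  summed.\<close>

lemma strong_markov:
  assumes [measurable]: "F \<in> borel_measurable path_space"
  shows "(\<integral>\<^sup>+X. after_hit A F X \<partial>quenched \<omega> x) =
     (\<integral>\<^sup>+X. after_hit A (\<lambda>Y. \<integral>\<^sup>+Z. F Z \<partial>quenched \<omega> (Y 0)) X \<partial>quenched \<omega> x)"
proof -
  define T where "T H n X = (if X n \<in> A \<and> (\<forall>i<n. X i \<notin> A) then H (\<lambda>j. X (n + j)) else 0)"
    for H :: "(nat \<Rightarrow> int) \<Rightarrow> ennreal" and n and X :: "nat \<Rightarrow> int"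
  let ?G = "\<lambda>Y. \<integral>\<^sup>+Z. F Z \<partial>quenched \<omega> (Y 0)"
  have G [measurable]: "?G \<in> borel_measurable path_space"
    by (rule measurable_compose[of "\<lambda>Y. Y 0" _ "count_space UNIV"]) simp_all
  have T [measurable]: "T H n \<in> borel_measurable path_space" if "H \<in> borel_measurable path_space" for H n
    using measurable_at_first_hit[OF that] by (simp add: T_def[abs_def])
  have T0: "(\<integral>\<^sup>+X. T H 0 X \<partial>quenched \<omega> x) = indicator A x * (\<integral>\<^sup>+X. H X \<partial>quenched \<omega> x)"
    if [measurable]: "H \<in> borel_measurable path_space" for H x
  proof -
    have "(\<integral>\<^sup>+X. T H 0 X \<partial>quenched \<omega> x) = (\<integral>\<^sup>+X. indicator A x * H X \<partial>quenched \<omega> x)"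
      using AE_quenched_start[of x \<omega>] by (intro nn_integral_cong_AE) (auto simp: T_def)
    then show ?thesis by (simp add: nn_integral_cmult)
  qed
  \<comment> \<open>Prepending a point outside \<open>A\<close> delays the first hit by one; a point
    of \<open>A\<close> makes a later first hit impossible.\<close>
  have Suc_eq: "T H (Suc n) (case_nat x X) = indicator (- A) x * T H n X" for H n x X
    unfolding T_def All_less_Suc2 by (auto simp: indicator_def)
  have TS: "(\<integral>\<^sup>+X. T H (Suc n) X \<partial>quenched \<omega> x) =
       (\<integral>\<^sup>+y. indicator (- A) x * (\<integral>\<^sup>+X. T H n X \<partial>quenched \<omega> y) \<partial>jump \<omega> x)"
    if [measurable]: "H \<in> borel_measurable path_space" for H n x
    by (subst nn_integral_quenched_step) (simp_all add: Suc_eq nn_integral_cmult)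
  have "(\<integral>\<^sup>+X. T F n X \<partial>quenched \<omega> x) = (\<integral>\<^sup>+X. T ?G n X \<partial>quenched \<omega> x)" for n x
  proof (induction n arbitrary: x)
    case 0
    have "(\<integral>\<^sup>+X. ?G X \<partial>quenched \<omega> x) = (\<integral>\<^sup>+X. (\<integral>\<^sup>+Z. F Z \<partial>quenched \<omega> x) \<partial>quenched \<omega> x)"
      using AE_quenched_start[of x \<omega>] by (intro nn_integral_cong_AE) auto
    then show ?case
      by (simp add: T0[OF assms] T0[OF G])
  next
    case (Suc n)
    show ?case
      unfolding TS[OF assms] TS[OF G] Suc.IH ..
  qed
  moreover have "(\<integral>\<^sup>+X. after_hit A H X \<partial>quenched \<omega> x) = (\<Sum>n. \<integral>\<^sup>+X. T H n X \<partial>quenched \<omega> x)"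
    if "H \<in> borel_measurable path_space" for H
  proof -
    have "T H n \<in> borel_measurable (quenched \<omega> x)" for n
      using T[OF that] by simp
    then have "(\<integral>\<^sup>+X. (\<Sum>n. T H n X) \<partial>quenched \<omega> x) = (\<Sum>n. \<integral>\<^sup>+X. T H n X \<partial>quenched \<omega> x)"
      by (rule nn_integral_suminf)
    then show ?thesis by (simp add: after_hit_def T_def)
  qed
  note this[OF assms] this[OF G]
  ultimately show ?thesis
    by (simp only:)
qed

lemma nn_integral_after_hit_le:
  assumes "F \<in> borel_measurable path_space" "\<And>z. z \<in> A \<Longrightarrow> (\<integral>\<^sup>+X. F X \<partial>quenched \<omega> z) \<le> c"
  shows "(\<integral>\<^sup>+X. after_hit A F X \<partial>quenched \<omega> x) \<le> c"
proof -
  have "after_hit A (\<lambda>Y. \<integral>\<^sup>+Z. F Z \<partial>quenched \<omega> (Y 0)) X \<le> c" for X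
    using assms(2) by (cases rule: first_hit_cases[of X A]) (simp_all add: after_hit_never after_hit_first)
  then have "(\<integral>\<^sup>+X. after_hit A F X \<partial>quenched \<omega> x) \<le> (\<integral>\<^sup>+X. c \<partial>quenched \<omega> x)"
    unfolding strong_markov[OF assms(1)] by (intro nn_integral_mono)
  then show ?thesis
    by simp
qed

text \<open>The entry point is known only to lie in \<open>B\<close>, so the lower bound is taken
  uniform over \<open>B\<close>.\<close>

lemma nn_integral_after_hit_ge:
  assumes F: "F \<in> borel_measurable path_space" "\<And>z. z \<in> B \<Longrightarrow> c \<le> (\<integral>\<^sup>+X. F X \<partial>quenched \<omega> z)"
    and hit: "AE X in quenched \<omega> x. \<exists>m. X m \<in> A \<and> (\<forall>i<m. X i \<notin> A) \<and> X m \<in> B"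
  shows "c \<le> (\<integral>\<^sup>+X. after_hit A F X \<partial>quenched \<omega> x)"
proof -
  have "AE X in quenched \<omega> x. c \<le> after_hit A (\<lambda>Y. \<integral>\<^sup>+Z. F Z \<partial>quenched \<omega> (Y 0)) X"
    using hit by eventually_elim (auto simp: after_hit_first intro!: F(2))
  then have "(\<integral>\<^sup>+X. c \<partial>quenched \<omega> x) \<le> (\<integral>\<^sup>+X. after_hit A F X \<partial>quenched \<omega> x)"
    unfolding strong_markov[OF F(1)] by (intro nn_integral_mono_AE)
  then show ?thesis
    by simp
qed

text \<open>Transfers statements about transition probabilities to paths. After a first step, a
  forbidden jump at time \<open>Suc n\<close> becomes one at time \<open>n\<close>.\<close>

lemma AE_quenched_trans_prob: "AE X in quenched \<omega> x. \<forall>n. trans_prob \<omega> (X n) (X (Suc n)) \<noteq> 0"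
proof (subst AE_all_countable, rule allI)
  fix n
  let ?F = "\<lambda>n X. if trans_prob \<omega> (X n) (X (Suc n)) = 0 then 1 else 0 :: ennreal"
  have F: "?F n \<in> borel_measurable path_space" for n
    by (rule measurable_path_pair) simp
  have null: "(\<integral>\<^sup>+X. ?F n X \<partial>quenched \<omega> x) = 0" for x
  proof (induction n arbitrary: x)
    case 0
    have "(\<integral>\<^sup>+X. ?F 0 (case_nat x X) \<partial>quenched \<omega> y) = (\<integral>\<^sup>+X. (if trans_prob \<omega> x y = 0 then 1 else 0) \<partial>quenched \<omega> y)" for y
      using AE_quenched_start[of y \<omega>] by (intro nn_integral_cong_AE, eventually_elim) simp
    then have *: "(\<integral>\<^sup>+X. ?F 0 (case_nat x X) \<partial>quenched \<omega> y) = (if trans_prob \<omega> x y = 0 then 1 else 0)" for y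
      by simp
    have "(\<integral>\<^sup>+X. ?F 0 X \<partial>quenched \<omega> x) = (\<integral>\<^sup>+y. (if trans_prob \<omega> x y = 0 then 1 else 0) \<partial>jump \<omega> x)"
      by (subst nn_integral_quenched_step[OF F]) (simp only: *)
    also have "\<dots> = 0"
      by (subst nn_integral_0_iff_AE) (auto simp: AE_measure_pmf_iff set_pmf_iff pmf_jump)
    finally show ?case .
  next
    case (Suc n)
    then show ?case
      by (subst nn_integral_quenched_step[OF F]) simp
  qed
  have "?F n \<in> borel_measurable (quenched \<omega> x)"
    unfolding measurable_cong_sets[OF sets_quenched refl] by (rule F)
  from nn_integral_0_iff_AE[OF this] null have "AE X in quenched \<omega> x. ?F n X = 0"
    by (rule iffD1)
  then show "AE X in quenched \<omega> x. trans_prob \<omega> (X n) (X (Suc n)) \<noteq> 0"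
    by eventually_elim (auto split: if_splits)
qed

text \<open>The times counted by \<open>after_hit A (cnt C D M)\<close> for unlimited
  \<open>M\<close>, on the clock of the whole path. This common clock allows different sites to be
  compared at the same time.\<close>

definition counted_times :: "int set \<Rightarrow> int set \<Rightarrow> int set \<Rightarrow> (nat \<Rightarrow> int) \<Rightarrow> nat set" where
  "counted_times A C D X = {j. \<exists>m\<le>j. X m \<in> A \<and> (\<forall>i<m. X i \<notin> A) \<and> X j \<in> C \<and> (\<forall>i\<in>{m..j}. X i \<notin> D)}"

lemma cnt_eq_card: "cnt C D M X = of_nat (card {j. j < M \<and> X j \<in> C \<and> (\<forall>i\<le>j. X i \<notin> D)})"
  unfolding cnt_def by (simp add: sum.If_cases Int_def)

lemma counted_times_first:
  assumes "X m \<in> A" "\<And>i. i < m \<Longrightarrow> X i \<notin> A"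
  shows "counted_times A C D X = (+) m ` {j. X (m + j) \<in> C \<and> (\<forall>i\<le>j. X (m + i) \<notin> D)}"
proof -
  have "X n \<in> A \<and> (\<forall>i<n. X i \<notin> A) \<longleftrightarrow> n = m" for n
    using assms by (cases n m rule: linorder_cases) auto
  moreover have "counted_times A C D X =
      {j. \<exists>n. (X n \<in> A \<and> (\<forall>i<n. X i \<notin> A)) \<and> n \<le> j \<and> X j \<in> C \<and> (\<forall>i\<in>{n..j}. X i \<notin> D)}"
    by (simp add: counted_times_def conj_ac)
  ultimately have "counted_times A C D X = {j. m \<le> j \<and> X j \<in> C \<and> (\<forall>i\<in>{m..j}. X i \<notin> D)}"
    by simp
  also have "\<dots> = (+) m ` {j. X (m + j) \<in> C \<and> (\<forall>i\<le>j. X (m + i) \<notin> D)}"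
  proof (intro set_eqI iffI)
    fix j assume j: "j \<in> {j. m \<le> j \<and> X j \<in> C \<and> (\<forall>i\<in>{m..j}. X i \<notin> D)}"
    then show "j \<in> (+) m ` {j. X (m + j) \<in> C \<and> (\<forall>i\<le>j. X (m + i) \<notin> D)}"
      by (intro image_eqI[of _ _ "j - m"]) auto
  next
    fix j assume "j \<in> (+) m ` {j. X (m + j) \<in> C \<and> (\<forall>i\<le>j. X (m + i) \<notin> D)}"
    then obtain l where l: "j = m + l" "X j \<in> C" "\<And>i. i \<le> l \<Longrightarrow> X (m + i) \<notin> D" by auto
    have "X i \<notin> D" if "i \<in> {m..j}" for i
    proof -
      have "i - m \<le> l" "m + (i - m) = i"
        using that l(1) by auto
      then show ?thesis using l(3)[of "i - m"] by simp
    qed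
    then show "j \<in> {j. m \<le> j \<and> X j \<in> C \<and> (\<forall>i\<in>{m..j}. X i \<notin> D)}"
      using l by auto
  qed
  finally show ?thesis .
qed

text \<open>The window of \<open>M\<close> steps after the hit covers only counted times, and it
  covers all those before absolute time \<open>M\<close>.\<close>

lemma
  shows after_hit_cnt_le: "after_hit A (cnt C D M) X \<le> emeasure (count_space UNIV) (counted_times A C D X)"
    and after_hit_cnt_ge: "of_nat (card (counted_times A C D X \<inter> {..<M})) \<le> after_hit A (cnt C D M) X"
proof -
  show "after_hit A (cnt C D M) X \<le> emeasure (count_space UNIV) (counted_times A C D X)"
  proof (cases rule: first_hit_cases[of X A])
    case (hit m)
    let ?S = "{j. j < M \<and> X (m + j) \<in> C \<and> (\<forall>i\<le>j. X (m + i) \<notin> D)}"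
    have eq: "counted_times A C D X = (+) m ` {j. X (m + j) \<in> C \<and> (\<forall>i\<le>j. X (m + i) \<notin> D)}"
      using hit by (rule counted_times_first)
    have "after_hit A (cnt C D M) X = of_nat (card ((+) m ` ?S))"
      by (simp add: after_hit_first[of X m A, OF hit] cnt_eq_card card_image)
    also have "\<dots> = emeasure (count_space UNIV) ((+) m ` ?S)"
      by (subst emeasure_count_space_finite) auto
    also have "\<dots> \<le> emeasure (count_space UNIV) (counted_times A C D X)"
      unfolding eq by (rule emeasure_mono) auto
    finally show ?thesis .
  qed (simp add: after_hit_never)
  show "of_nat (card (counted_times A C D X \<inter> {..<M})) \<le> after_hit A (cnt C D M) X"
  proof (cases rule: first_hit_cases[of X A])
    case never
    then show ?thesis by (simp add: counted_times_def)
  next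
    case (hit m)
    let ?S = "{j. j < M \<and> X (m + j) \<in> C \<and> (\<forall>i\<le>j. X (m + i) \<notin> D)}"
    have eq: "counted_times A C D X = (+) m ` {j. X (m + j) \<in> C \<and> (\<forall>i\<le>j. X (m + i) \<notin> D)}"
      using hit by (rule counted_times_first)
    have "card (counted_times A C D X \<inter> {..<M}) \<le> card ((+) m ` ?S)"
      unfolding eq by (rule card_mono) auto
    then show ?thesis
      by (simp add: after_hit_first[of X m A, OF hit] cnt_eq_card card_image)
  qed
qed

section \<open>Linear growth and occupation times\<close>

lemma nn_integral_const_prob_space: "prob_space M \<Longrightarrow> (\<integral>\<^sup>+x. c \<partial>M) = c"
  using prob_space.emeasure_space_1 by fastforce

text \<open>\<open>T\<close> lies in an interval of length \<open>N\<close> that starts at its least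
  element.\<close>

lemma card_le_if_spread:
  fixes T :: "nat set"
  assumes "\<And>k k'. k \<in> T \<Longrightarrow> k' \<in> T \<Longrightarrow> k' < k + N"
  shows "finite T \<and> card T \<le> N"
proof (cases "T = {}")
  case False
  then have "(LEAST k. k \<in> T) \<in> T"
    by (meson LeastI ex_in_conv)
  then have "T \<subseteq> {(LEAST k. k \<in> T)..<(LEAST k. k \<in> T) + N}"
    using assms by (auto simp: Least_le)
  then show ?thesis
    using card_mono[of "{(LEAST k. k \<in> T)..<(LEAST k. k \<in> T) + N}" T] by (auto dest: finite_subset)
qed simp

text \<open>Just before a positive entry time the path is at most \<open>t - 1\<close>, so it lands
  at most \<open>R - 1\<close> beyond \<open>t\<close>.\<close>

lemma first_entry_bounded_jumps:
  fixes X :: "nat \<Rightarrow> int"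
  assumes "X 0 \<le> t" "R > 0" "\<And>n. X (Suc n) \<le> X n + R" "\<exists>n. t \<le> X n"
  shows "\<exists>m. X m \<in> {t..} \<and> (\<forall>i<m. X i \<notin> {t..}) \<and> X m \<in> {t..t + R - 1}"
proof (cases rule: first_hit_cases[of X "{t..}"])
  case (hit m)
  have "X m \<le> t + R - 1"
  proof (cases m)
    case 0
    then show ?thesis using assms(1,2) by simp
  next
    case (Suc l)
    then have "X l < t" using hit(2)[of l] by simp
    then show ?thesis using assms(3)[of l] Suc by simp
  qed
  then show ?thesis using hit by auto
qed (use assms(4) in auto)

lemma eventually_few_small_times:
  fixes X :: "nat \<Rightarrow> int"
  assumes lim: "(\<lambda>n. X n / n) \<longlonglongrightarrow> v" and v: "v > 0"
  shows "\<forall>\<^sub>F n in sequentially. emeasure (count_space UNIV) {j. X j \<le> int n + K} \<le> ennreal (3 / v * n)"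
proof -
  have "\<forall>\<^sub>F j in sequentially. v / 2 < X j / j"
    using order_tendstoD(1)[OF lim, of "v / 2"] v by simp
  then obtain j0 where j0: "\<And>j. j \<ge> j0 \<Longrightarrow> v / 2 < X j / j"
    by (auto simp: eventually_sequentially)
  \<comment> \<open>Since eventually \<open>X j > v / 2 * j\<close>, the relevant times are below
    \<open>2 * (n + \<bar>K\<bar>) / v\<close> up to rounding and \<open>j0\<close>. Here
    \<open>a\<close> collects all terms that do not grow with \<open>n\<close>; once
    \<open>n \<ge> v * a\<close> they are at most \<open>n / v\<close>, which turns the 2 into
    3.\<close>
  define a where "a = real j0 + 2 + 2 * \<bar>K\<bar> / v"
  have "emeasure (count_space UNIV) {j. X j \<le> int n + K} \<le> ennreal (3 / v * n)" if n: "real n \<ge> v * a" for n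
  proof -
    define N where "N = j0 + nat \<lceil>2 * (n + \<bar>K\<bar>) / v\<rceil> + 1"
    have "{j. X j \<le> int n + K} \<subseteq> {..<N}"
    proof
      fix j assume "j \<in> {j. X j \<le> int n + K}"
      then have j: "X j \<le> int n + K" by simp
      show "j \<in> {..<N}"
      proof (rule ccontr)
        assume "j \<notin> {..<N}"
        then have jN: "j \<ge> N" by simp
        then have "j > 0" "j \<ge> j0" by (simp_all add: N_def)
        then have "v / 2 * j < X j"
          using j0[of j] by (simp add: field_simps)
        also have "real_of_int (X j) \<le> n + \<bar>K\<bar>"
          using j by linarith
        finally have "real j < 2 * (n + \<bar>K\<bar>) / v"
          using v by (simp add: field_simps)
        then show False
          using jN unfolding N_def by linarith
      qed
    qed
    then have "emeasure (count_space UNIV) {j. X j \<le> int n + K} \<le> emeasure (count_space UNIV) {..<N}"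
      by (intro emeasure_mono) auto
    also have "\<dots> = ennreal (real N)"
      by (simp add: ennreal_of_nat_eq_real_of_nat)
    also have "\<dots> \<le> ennreal (3 / v * n)"
    proof (rule ennreal_leI)
      have "0 \<le> 2 * (n + \<bar>K\<bar>) / v" using v by simp
      then have "real N \<le> j0 + (2 * (n + \<bar>K\<bar>) / v + 1) + 1"
        unfolding N_def by linarith
      also have "\<dots> = a + 2 / v * n"
        by (simp add: a_def add_divide_distrib algebra_simps)
      also have "a \<le> n / v"
        using n v by (simp add: field_simps)
      finally show "real N \<le> 3 / v * n"
        by (simp add: field_simps)
    qed
    finally show ?thesis .
  qed
  moreover have "\<forall>\<^sub>F n in sequentially. real n \<ge> v * a"
    using eventually_ge_at_top[of "nat \<lceil>v * a\<rceil>"] by eventually_elim linarith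
  ultimately show ?thesis
    by (rule eventually_mono[rotated])
qed

text \<open>The property says that the quenched probability of the exceptional set, a measurable
  function of the environment, vanishes.\<close>

lemma pred_AE_quenched:
  assumes Q: "Measurable.pred path_space Q"
  shows "Measurable.pred env_product (\<lambda>\<omega>. AE X in quenched \<omega> x. Q X)"
proof -
  have B: "{X. \<not> Q X} \<in> sets path_space"
    using sets.sets_Collect_neg[OF Q[unfolded pred_def]] by simp
  have [measurable]: "(\<lambda>\<omega>. \<integral>\<^sup>+X. indicator {X. \<not> Q X} X \<partial>quenched \<omega> x) \<in> borel_measurable env_product"
    using B by (intro measurable_nn_integral_quenched) simp
  have "(AE X in quenched \<omega> x. Q X) \<longleftrightarrow> (\<integral>\<^sup>+X. indicator {X. \<not> Q X} X \<partial>quenched \<omega> x) = 0" for \<omega>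
    using B by (subst AE_iff_measurable[where N = "{X. \<not> Q X}"]) auto
  then show ?thesis
    by simp
qed

section \<open>The annealed law of the path\<close>

context iid_environment
begin

definition walk :: "(nat \<Rightarrow> int) measure" where
  "walk = env \<bind> (\<lambda>\<omega>. quenched \<omega> 0)"

lemma measurable_quenched_env: "(\<lambda>\<omega>. quenched \<omega> x) \<in> measurable env (prob_algebra path_space)"
  by simp

lemma env_in_prob_algebra: "env \<in> space (prob_algebra env)"
  by (simp add: space_prob_algebra env.prob_space_axioms)

lemma sets_walk [simp, measurable_cong]: "sets walk = sets path_space"
  unfolding walk_def by (rule sets_bind'[OF env_in_prob_algebra measurable_quenched_env])

lemma prob_space_walk: "prob_space walk"
  unfolding walk_def by (rule prob_space_bind'[OF env_in_prob_algebra measurable_quenched_env])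

lemma nn_integral_walk:
  assumes "F \<in> borel_measurable path_space"
  shows "(\<integral>\<^sup>+X. F X \<partial>walk) = (\<integral>\<^sup>+\<omega>. \<integral>\<^sup>+X. F X \<partial>quenched \<omega> 0 \<partial>env)"
  unfolding walk_def
  by (rule nn_integral_bind[OF assms measurable_prob_algebraD[OF measurable_quenched_env]])

lemma AE_walk:
  assumes "Measurable.pred path_space P"
  shows "(AE X in walk. P X) \<longleftrightarrow> (AE \<omega> in env. AE X in quenched \<omega> 0. P X)"
  unfolding walk_def
  by (rule AE_bind[OF measurable_prob_algebraD[OF measurable_quenched_env] assms])

lemma AE_walk_start: "AE X in walk. X 0 = 0"
  by (subst AE_walk) (simp_all add: AE_quenched_start)

lemma nn_integral_green_shift:
  "(\<integral>\<^sup>+\<omega>. green \<omega> ((+) k ` C) ((+) k ` D) n k \<partial>env) = (\<integral>\<^sup>+\<omega>. green \<omega> C D n 0 \<partial>env)"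
  using nn_integral_shift[of "\<lambda>\<omega>. green \<omega> C D n 0" k] by (simp add: green_shift)

lemma nn_integral_min_green_shift:
  "(\<integral>\<^sup>+\<omega>. min_green \<omega> ((+) k ` C) ((+) k ` D) n ((+) k ` W) \<partial>env) = (\<integral>\<^sup>+\<omega>. min_green \<omega> C D n W \<partial>env)"
  using nn_integral_shift[of "\<lambda>\<omega>. min_green \<omega> C D n W" k] by (simp add: min_green_shift)

text \<open>Finiteness of the mean of the untruncated count, expressed by truncations; monotone
  convergence links the two.\<close>

definition bounded_green :: "int set \<Rightarrow> int set \<Rightarrow> bool" where
  "bounded_green C D \<longleftrightarrow> (\<exists>c<\<top>. \<forall>n. (\<integral>\<^sup>+\<omega>. green \<omega> C D n 0 \<partial>env) \<le> c)"

lemma nn_integral_Sup_cnt_less_top_iff: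
  assumes "\<And>X. F X = (SUP n. cnt C D n X)"
  shows "(\<integral>\<^sup>+\<omega>. \<integral>\<^sup>+X. F X \<partial>quenched \<omega> 0 \<partial>env) < \<top> \<longleftrightarrow> bounded_green C D"
proof -
  have "(\<integral>\<^sup>+X. F X \<partial>quenched \<omega> 0) = (SUP n. green \<omega> C D n 0)" for \<omega>
    unfolding assms green_def
    by (rule nn_integral_monotone_convergence_SUP) (auto simp: incseq_def le_fun_def intro: cnt_mono)
  then have "(\<integral>\<^sup>+\<omega>. \<integral>\<^sup>+X. F X \<partial>quenched \<omega> 0 \<partial>env) = (\<integral>\<^sup>+\<omega>. (SUP n. green \<omega> C D n 0) \<partial>env)"
    by simp
  also have "\<dots> = (SUP n. \<integral>\<^sup>+\<omega>. green \<omega> C D n 0 \<partial>env)"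
    by (rule nn_integral_monotone_convergence_SUP) (auto simp: incseq_def le_fun_def intro: green_mono)
  finally have eq: "(\<integral>\<^sup>+\<omega>. \<integral>\<^sup>+X. F X \<partial>quenched \<omega> 0 \<partial>env) = (SUP n. \<integral>\<^sup>+\<omega>. green \<omega> C D n 0 \<partial>env)" .
  show ?thesis
    unfolding eq bounded_green_def
  proof (intro iffI)
    assume "(SUP n. \<integral>\<^sup>+\<omega>. green \<omega> C D n 0 \<partial>env) < \<top>"
    then show "\<exists>c<\<top>. \<forall>n. (\<integral>\<^sup>+\<omega>. green \<omega> C D n 0 \<partial>env) \<le> c"
      by (intro exI[of _ "SUP n. \<integral>\<^sup>+\<omega>. green \<omega> C D n 0 \<partial>env"] conjI allI SUP_upper) simp_all
  next
    assume "\<exists>c<\<top>. \<forall>n. (\<integral>\<^sup>+\<omega>. green \<omega> C D n 0 \<partial>env) \<le> c"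
    then obtain c where "c < \<top>" "\<And>n. (\<integral>\<^sup>+\<omega>. green \<omega> C D n 0 \<partial>env) \<le> c"
      by (elim exE conjE) auto
    then show "(SUP n. \<integral>\<^sup>+\<omega>. green \<omega> C D n 0 \<partial>env) < \<top>"
      by (intro le_less_trans[OF SUP_least])
  qed
qed

text \<open>After the first visit to \<open>k\<close> the walk starts afresh at \<open>k\<close>,
  and stationarity moves \<open>k\<close> to 0. Never visiting \<open>k\<close> contributes 0, hence
  an inequality.\<close>

lemma nn_integral_walk_after_hit_le:
  "(\<integral>\<^sup>+X. after_hit {k} (cnt ((+) k ` C) ((+) k ` D) M) X \<partial>walk) \<le> (\<integral>\<^sup>+\<omega>. green \<omega> C D M 0 \<partial>env)"
proof -
  have "(\<integral>\<^sup>+X. after_hit {k} (cnt ((+) k ` C) ((+) k ` D) M) X \<partial>walk) \<le>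
      (\<integral>\<^sup>+\<omega>. green \<omega> ((+) k ` C) ((+) k ` D) M k \<partial>env)"
    by (subst nn_integral_walk)
       (auto intro!: measurable_after_hit nn_integral_mono nn_integral_after_hit_le simp: green_def)
  then show ?thesis by (simp add: nn_integral_green_shift)
qed

text \<open>The target is \<open>k + R\<close>. The walk enters \<open>{k..}\<close> in one of the
  sites \<open>k, ..., k + R - 1\<close>, which lie at \<open>-R, ..., -1\<close> relative to the
  target and hence in the translate of \<open>W\<close>.\<close>

lemma nn_integral_walk_after_hit_ge:
  assumes hit: "AE X in walk. \<forall>n. X (Suc n) \<le> X n + R" "AE X in walk. \<exists>n. int k \<le> X n"
    and R: "R > 0" and W: "{- R..-1} \<subseteq> W"
  shows "(\<integral>\<^sup>+\<omega>. min_green \<omega> C D M W \<partial>env) \<le>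
    (\<integral>\<^sup>+X. after_hit {int k..} (cnt ((+) (k + R) ` C) ((+) (k + R) ` D) M) X \<partial>walk)"
proof -
  have "AE X in walk. \<exists>m. X m \<in> {int k..} \<and> (\<forall>i<m. X i \<notin> {int k..}) \<and> X m \<in> {int k..k + R - 1}"
    using hit AE_walk_start
    by eventually_elim (intro first_entry_bounded_jumps R; auto)
  then have ae: "AE \<omega> in env. AE X in quenched \<omega> 0.
      \<exists>m. X m \<in> {int k..} \<and> (\<forall>i<m. X i \<notin> {int k..}) \<and> X m \<in> {int k..k + R - 1}"
    by (subst (asm) AE_walk) simp_all
  have "(\<integral>\<^sup>+\<omega>. min_green \<omega> C D M W \<partial>env) =
     (\<integral>\<^sup>+\<omega>. min_green \<omega> ((+) (k + R) ` C) ((+) (k + R) ` D) M ((+) (k + R) ` W) \<partial>env)"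
    by (rule nn_integral_min_green_shift[symmetric])
  also have "\<dots> \<le> (\<integral>\<^sup>+\<omega>. \<integral>\<^sup>+X. after_hit {int k..} (cnt ((+) (k + R) ` C) ((+) (k + R) ` D) M) X
       \<partial>quenched \<omega> 0 \<partial>env)"
  proof (rule nn_integral_mono_AE, use ae in eventually_elim)
    fix \<omega> assume ae: "AE X in quenched \<omega> 0.
      \<exists>m. X m \<in> {int k..} \<and> (\<forall>i<m. X i \<notin> {int k..}) \<and> X m \<in> {int k..k + R - 1}"
    show "min_green \<omega> ((+) (k + R) ` C) ((+) (k + R) ` D) M ((+) (k + R) ` W) \<le>
        (\<integral>\<^sup>+X. after_hit {int k..} (cnt ((+) (k + R) ` C) ((+) (k + R) ` D) M) X \<partial>quenched \<omega> 0)"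
    proof (rule nn_integral_after_hit_ge[OF measurable_cnt _ ae])
      fix z assume "z \<in> {int k..k + R - 1}"
      then have "z - (k + R) \<in> W"
        using W by auto
      then have "z \<in> (+) (k + R) ` W"
        by (rule rev_image_eqI) simp
      then show "min_green \<omega> ((+) (k + R) ` C) ((+) (k + R) ` D) M ((+) (k + R) ` W) \<le>
          (\<integral>\<^sup>+X. cnt ((+) (k + R) ` C) ((+) (k + R) ` D) M X \<partial>quenched \<omega> z)"
        unfolding min_green_def green_def by (rule INF_lower)
    qed
  qed
  also have "\<dots> = (\<integral>\<^sup>+X. after_hit {int k..} (cnt ((+) (k + R) ` C) ((+) (k + R) ` D) M) X \<partial>walk)"
    by (rule nn_integral_walk[symmetric]) (intro measurable_after_hit measurable_cnt)
  finally show ?thesis .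
qed

end

lemma after_hit_le: "(\<And>X. F X \<le> c) \<Longrightarrow> after_hit A F X \<le> c"
  by (cases rule: first_hit_cases[of X A]) (simp_all add: after_hit_never after_hit_first)

text \<open>Exchange the sums over sites and times: each time in \<open>J\<close> is counted for at
  most \<open>B\<close> sites, any other time for none.\<close>

lemma sum_counted_times_le:
  fixes S :: "nat \<Rightarrow> nat set"
  assumes few: "\<And>j. finite {k. j \<in> S k} \<and> card {k. j \<in> S k} \<le> B"
    and small: "\<And>k j. k < n \<Longrightarrow> j \<in> S k \<Longrightarrow> j \<in> J"
  shows "(\<Sum>k<n. emeasure (count_space UNIV) (S k)) \<le> of_nat B * emeasure (count_space UNIV) J"
proof -
  have "(\<Sum>k<n. emeasure (count_space UNIV) (S k)) = (\<Sum>k<n. \<integral>\<^sup>+j. indicator (S k) j \<partial>count_space UNIV)"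
    by simp
  also have "\<dots> = (\<integral>\<^sup>+j. (\<Sum>k<n. indicator (S k) j) \<partial>count_space UNIV)"
    by (rule nn_integral_sum[symmetric]) simp
  also have "\<dots> \<le> (\<integral>\<^sup>+j. of_nat B * indicator J j \<partial>count_space UNIV)"
  proof (rule nn_integral_mono)
    fix j
    have "(\<Sum>k<n. indicator (S k) j :: ennreal) = of_nat (card {k. k < n \<and> j \<in> S k})"
      by (simp add: indicator_def sum.If_cases Int_def)
    also have "\<dots> \<le> of_nat B * indicator J j"
    proof (cases "j \<in> J")
      case True
      have "card {k. k < n \<and> j \<in> S k} \<le> card {k. j \<in> S k}"
        using few by (intro card_mono) auto
      then show ?thesis
        using few[of j] True by simp
    next
      case False
      then have "{k. k < n \<and> j \<in> S k} = {}"
        using small by blast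
      then show ?thesis by (simp only: card.empty) simp
    qed
    finally show "(\<Sum>k<n. indicator (S k) j) \<le> of_nat B * (indicator J j :: ennreal)" .
  qed
  also have "\<dots> = of_nat B * emeasure (count_space UNIV) J"
    by (simp add: nn_integral_cmult)
  finally show ?thesis .
qed

lemma card_UN_counted_ge:
  fixes S :: "nat \<Rightarrow> nat set"
  assumes J: "finite J" "J \<subseteq> {..<M}" and cover: "\<And>j. j \<in> J \<Longrightarrow> \<exists>k<n. j \<in> S k"
  shows "card J \<le> (\<Sum>k<n. card (S k \<inter> {..<M}))"
proof -
  have "J \<subseteq> (\<Union>k\<in>{..<n}. S k \<inter> {..<M})"
    using J cover by fast
  then have "card J \<le> card (\<Union>k\<in>{..<n}. S k \<inter> {..<M})"
    by (intro card_mono) auto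
  also have "\<dots> \<le> (\<Sum>k<n. card (S k \<inter> {..<M}))"
    by (rule card_UN_le) simp
  finally show ?thesis .
qed

text \<open>Without positive speed, \<open>X i\<close> is eventually below \<open>i / Suc q\<close>,
  so the walk stays below \<open>n\<close> up to time \<open>Suc q * n\<close>. Dropping at most
  \<open>n\<close> initial times leaves \<open>q * n\<close> of them with the walk
  nonnegative.\<close>

lemma eventually_slow_times:
  fixes X :: "nat \<Rightarrow> int"
  assumes lim: "(\<lambda>n. X n / n) \<longlonglongrightarrow> v" and v: "v \<le> 0" and pos: "\<exists>j0. \<forall>j\<ge>j0. 0 \<le> X j"
  shows "\<forall>\<^sub>F n in sequentially. \<exists>J\<subseteq>{..<Suc q * n}. q * n \<le> card J \<and>
           (\<forall>j\<in>J. 0 \<le> X j \<and> (\<forall>i\<le>j. X i < int n))"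
proof -
  obtain j0 where j0: "\<And>j. j \<ge> j0 \<Longrightarrow> 0 \<le> X j"
    using pos by blast
  have "\<forall>\<^sub>F j in sequentially. X j / j < 1 / Suc q"
    using order_tendstoD(2)[OF lim, of "1 / Suc q"] v by (simp add: order_le_less_trans[of v 0])
  then obtain j1 where j1: "\<And>j. j \<ge> j1 \<Longrightarrow> X j / j < 1 / Suc q"
    by (auto simp: eventually_sequentially)
  define c where "c = Max (X ` {..j1})"
  have "\<exists>J\<subseteq>{..<Suc q * n}. q * n \<le> card J \<and> (\<forall>j\<in>J. 0 \<le> X j \<and> (\<forall>i\<le>j. X i < int n))"
    if n: "n \<ge> j0 + nat c + 1" for n
  proof (intro exI[of _ "{j0..<Suc q * n}"] conjI ballI allI impI)
    show "q * n \<le> card {j0..<Suc q * n}"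
      using n by simp
    fix j assume j: "j \<in> {j0..<Suc q * n}"
    then show "0 \<le> X j" using j0 by simp
    fix i assume i: "i \<le> j"
    show "X i < int n"
    proof (cases "i \<le> j1")
      case True
      then have "X i \<le> c" unfolding c_def by (intro Max_ge) auto
      then show ?thesis using n by linarith
    next
      case False
      then have "real_of_int (X i) < i / Suc q"
        using j1[of i] by (simp add: field_simps)
      also have "i < Suc q * n" using i j by simp
      then have "real i / Suc q < n"
        by (simp add: field_simps flip: of_nat_Suc of_nat_mult)
      finally show ?thesis by linarith
    qed
  qed auto
  then show ?thesis
    unfolding eventually_sequentially by blast
qed

section \<open>The two implications between positive speed and finite occupation times\<close>

context iid_environment
begin

text \<open>\<open>small\<close> confines the times counted for the first \<open>n\<close> sites to
  those spent below level \<open>n + K\<close>, whose number positive speed bounds linearly in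
  \<open>n\<close>. \<open>few\<close> bounds how often each of them is counted.\<close>

lemma bounded_green_if_ballistic:
  fixes R K :: int
  assumes lim: "AE X in walk. (\<lambda>n. X n / n) \<longlonglongrightarrow> v" and v: "v > 0"
    and jumps: "AE X in walk. \<forall>n. X (Suc n) \<le> X n + R" and R: "R > 0"
    and W: "dominates c m W" "c < \<top>" "{- R..-1} \<subseteq> W" "D \<inter> W = {}"
    and few: "\<And>X j. finite {k::nat. j \<in> counted_times {int k..} ((+) (k + R) ` C) ((+) (k + R) ` D) X} \<and>
      card {k::nat. j \<in> counted_times {int k..} ((+) (k + R) ` C) ((+) (k + R) ` D) X} \<le> B"
    and small: "\<And>X j k. j \<in> counted_times {int k..} ((+) (k + R) ` C) ((+) (k + R) ` D) X \<Longrightarrow> X j \<le> k + K"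
  shows "bounded_green C D"
proof -
  define \<Phi> where "\<Phi> M k = after_hit {int k..} (cnt ((+) (k + R) ` C) ((+) (k + R) ` D) M)" for M k
  define G where "G M n X = (\<Sum>k<Suc n. \<Phi> M k X) / of_nat (Suc n)" for M n X
  define \<phi> where "\<phi> M = (\<integral>\<^sup>+\<omega>. min_green \<omega> C D M W \<partial>env)" for M
  \<comment> \<open>At most \<open>3 / v\<close> times per site, each counted at most
    \<open>B\<close> times; crucially \<open>b\<close> does not depend on the truncation
    \<open>M\<close>.\<close>
  define b where "b = ennreal (B * (3 / v))"
  have \<Phi>_meas: "\<Phi> M k \<in> borel_measurable walk" for M k
    unfolding \<Phi>_def measurable_cong_sets[OF sets_walk refl] by (intro measurable_after_hit measurable_cnt)
  have G_meas: "G M n \<in> borel_measurable walk" for M n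
    unfolding G_def divide_ennreal_def
    by (intro borel_measurable_times_ennreal borel_measurable_sum \<Phi>_meas borel_measurable_const)
  have unbounded: "AE X in walk. \<exists>n. k \<le> X n" for k
    using lim
  proof eventually_elim
    fix X :: "nat \<Rightarrow> int" assume lim: "(\<lambda>n. X n / n) \<longlonglongrightarrow> v"
    have "\<forall>\<^sub>F n in sequentially. v / 2 < X n / n"
      using order_tendstoD(1)[OF lim, of "v / 2"] v by simp
    moreover have "\<forall>\<^sub>F n in sequentially. n \<ge> nat \<lceil>2 * \<bar>k\<bar> / v\<rceil> + 1"
      by (rule eventually_ge_at_top)
    ultimately have "\<forall>\<^sub>F n in sequentially. k \<le> X n"
    proof eventually_elim
      fix n assume n: "v / 2 < X n / n" "n \<ge> nat \<lceil>2 * \<bar>k\<bar> / v\<rceil> + 1"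
      then have "2 * \<bar>k\<bar> / v < n" by linarith
      then have "\<bar>k\<bar> < v / 2 * n" using v by (simp add: field_simps)
      also have "\<dots> < X n" using n by (simp add: field_simps)
      finally show "k \<le> X n" by linarith
    qed
    then show "\<exists>n. k \<le> X n"
      using eventually_happens by force
  qed
  have \<phi>_le: "\<phi> M \<le> (\<integral>\<^sup>+X. \<Phi> M k X \<partial>walk)" for M k
    unfolding \<phi>_def \<Phi>_def by (rule nn_integral_walk_after_hit_ge[OF jumps unbounded R W(3)])
  have \<phi>_le_G: "\<phi> M \<le> (\<integral>\<^sup>+X. G M n X \<partial>walk)" for M n
  proof -
    have "\<phi> M = (\<Sum>k<Suc n. \<phi> M) / of_nat (Suc n)"
      using mult_divide_eq_ennreal[of "of_nat (Suc n)" "\<phi> M"] by (simp add: mult.commute)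
    also have "\<dots> \<le> (\<Sum>k<Suc n. \<integral>\<^sup>+X. \<Phi> M k X \<partial>walk) / of_nat (Suc n)"
      by (intro divide_right_mono_ennreal sum_mono \<phi>_le)
    also have "\<dots> = (\<integral>\<^sup>+X. (\<Sum>k<Suc n. \<Phi> M k X) \<partial>walk) / of_nat (Suc n)"
      by (subst nn_integral_sum) (simp_all add: \<Phi>_meas)
    also have "\<dots> = (\<integral>\<^sup>+X. G M n X \<partial>walk)"
      unfolding G_def by (rule nn_integral_divide[symmetric]) (intro borel_measurable_sum \<Phi>_meas)
    finally show ?thesis .
  qed
  have G_le: "G M n X \<le> of_nat M" for M n X
  proof -
    have "G M n X \<le> (\<Sum>k<Suc n. of_nat M) / of_nat (Suc n)"
      unfolding G_def \<Phi>_def by (intro divide_right_mono_ennreal sum_mono after_hit_le cnt_le)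
    also have "\<dots> = of_nat M"
      using mult_divide_eq_ennreal[of "of_nat (Suc n)" "of_nat M"] by (simp add: mult.commute)
    finally show ?thesis .
  qed
  have limsup: "AE X in walk. limsup (\<lambda>n. G M n X) \<le> b" for M
    using lim
  proof eventually_elim
    fix X :: "nat \<Rightarrow> int" assume X: "(\<lambda>n. X n / n) \<longlonglongrightarrow> v"
    have "\<forall>\<^sub>F n in sequentially. emeasure (count_space UNIV) {j. X j \<le> int (Suc n) + K} \<le> ennreal (3 / v * Suc n)"
      using eventually_few_small_times[OF X v, of K]
      by (rule eventually_sequentially_Suc[THEN iffD2])
    then have "\<forall>\<^sub>F n in sequentially. G M n X \<le> b"
    proof eventually_elim
      fix n assume n: "emeasure (count_space UNIV) {j. X j \<le> int (Suc n) + K} \<le> ennreal (3 / v * Suc n)"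
      have "(\<Sum>k<Suc n. \<Phi> M k X) \<le> (\<Sum>k<Suc n. emeasure (count_space UNIV)
            (counted_times {int k..} ((+) (k + R) ` C) ((+) (k + R) ` D) X))"
        unfolding \<Phi>_def by (intro sum_mono after_hit_cnt_le)
      also have "\<dots> \<le> of_nat B * emeasure (count_space UNIV) {j. X j \<le> int (Suc n) + K}"
        using few by (rule sum_counted_times_le) (use small in fastforce)
      also have "\<dots> \<le> of_nat B * ennreal (3 / v * Suc n)"
        by (intro mult_left_mono n) simp
      also have "\<dots> = b * of_nat (Suc n)"
        using v by (simp add: b_def ennreal_of_nat_eq_real_of_nat ennreal_mult'[symmetric] mult_ac del: of_nat_Suc)
      finally have "G M n X \<le> b * of_nat (Suc n) / of_nat (Suc n)"
        unfolding G_def by (rule divide_right_mono_ennreal)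
      also have "\<dots> = b"
        by (rule mult_divide_eq_ennreal) auto
      finally show "G M n X \<le> b" .
    qed
    then show "limsup (\<lambda>n. G M n X) \<le> b"
      by (rule Limsup_bounded)
  qed
  have \<phi>_bound: "\<phi> M \<le> b" for M
  proof -
    have "\<phi> M \<le> liminf (\<lambda>n. \<integral>\<^sup>+X. G M n X \<partial>walk)"
      by (intro Liminf_bounded always_eventually allI \<phi>_le_G)
    also have "\<dots> \<le> limsup (\<lambda>n. \<integral>\<^sup>+X. G M n X \<partial>walk)"
      by (intro Liminf_le_Limsup) simp
    \<comment> \<open>Reverse Fatou needs an integrable majorant; the truncation at \<open>M\<close>
      supplies the constant \<open>M\<close>.\<close>
    also have "\<dots> \<le> (\<integral>\<^sup>+X. limsup (\<lambda>n. G M n X) \<partial>walk)"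
    proof (rule nn_integral_limsup[where w = "\<lambda>_. of_nat M"])
      show "(\<integral>\<^sup>+X. of_nat M \<partial>walk) < \<infinity>"
        by (simp add: prob_space.emeasure_space_1[OF prob_space_walk] of_nat_less_top)
    qed (simp_all add: G_meas G_le)
    also have "\<dots> \<le> (\<integral>\<^sup>+X. b \<partial>walk)"
      by (intro nn_integral_mono_AE limsup)
    also have "\<dots> = b"
      by (rule nn_integral_const_prob_space[OF prob_space_walk])
    finally show ?thesis .
  qed
  have "(\<integral>\<^sup>+\<omega>. green \<omega> C D n 0 \<partial>env) \<le> c * b" for n
  proof -
    have "(\<integral>\<^sup>+\<omega>. green \<omega> C D n 0 \<partial>env) \<le> c * \<phi> (n + m)"
      using W(1,4) by (simp add: dominates_def \<phi>_def)
    also have "\<dots> \<le> c * b"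
      by (intro mult_left_mono \<phi>_bound) simp
    finally show ?thesis .
  qed
  moreover have "c * b < \<top>"
    using W(2) by (simp add: b_def ennreal_mult_less_top)
  ultimately show ?thesis
    unfolding bounded_green_def by (intro exI[of _ "c * b"] conjI allI)
qed

text \<open>By \<open>cover\<close>, every time at which the walk is nonnegative and has so far
  stayed below \<open>n\<close> is counted for one of the first \<open>n\<close> sites. A slow walk
  has too many such times for the mean bound.\<close>

lemma ballistic_if_bounded_green:
  assumes lim: "AE X in walk. (\<lambda>n. X n / n) \<longlonglongrightarrow> v"
    and pos: "AE X in walk. \<exists>j0. \<forall>j\<ge>j0. 0 \<le> X j"
    and bounded: "bounded_green C D"
    and cover: "\<And>X j n. X 0 = 0 \<Longrightarrow> 0 \<le> X j \<Longrightarrow> \<forall>i\<le>j. X i < int n \<Longrightarrow>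
      \<exists>k<n. j \<in> counted_times {int k} ((+) k ` C) ((+) k ` D) X"
  shows "v > 0"
proof (rule ccontr)
  assume "\<not> v > 0"
  then have v: "v \<le> 0" by simp
  obtain c where c: "c < \<top>" "\<And>n. (\<integral>\<^sup>+\<omega>. green \<omega> C D n 0 \<partial>env) \<le> c"
    using bounded unfolding bounded_green_def by (elim exE conjE) auto
  \<comment> \<open>The mean per site is at most \<open>c\<close>, whereas zero or negative speed
    will force at least \<open>q\<close> counted times per site.\<close>
  obtain q where q: "c < of_nat q"
    using ennreal_Ex_less_of_nat[OF c(1)] by (elim exE)
  define Z where "Z M k = after_hit {int k} (cnt ((+) (int k) ` C) ((+) (int k) ` D) M)" for M k
  \<comment> \<open>The horizon grows with \<open>n\<close> to include all the slow times; this is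
    harmless because \<open>c\<close> is uniform in the horizon.\<close>
  define G where "G n X = (\<Sum>k<Suc n. Z (Suc q * Suc n) k X) / of_nat (Suc n)" for n X
  have Z_meas: "Z M k \<in> borel_measurable walk" for M k
    unfolding Z_def measurable_cong_sets[OF sets_walk refl] by (intro measurable_after_hit measurable_cnt)
  have G_meas: "G n \<in> borel_measurable walk" for n
    unfolding G_def divide_ennreal_def
    by (intro borel_measurable_times_ennreal borel_measurable_sum Z_meas borel_measurable_const)
  have Z_le: "(\<integral>\<^sup>+X. Z M k X \<partial>walk) \<le> c" for M k
    unfolding Z_def using nn_integral_walk_after_hit_le c(2) by (rule order_trans)
  have G_le: "(\<integral>\<^sup>+X. G n X \<partial>walk) \<le> c" for n
  proof -
    have "(\<integral>\<^sup>+X. G n X \<partial>walk) = (\<integral>\<^sup>+X. (\<Sum>k<Suc n. Z (Suc q * Suc n) k X) \<partial>walk) / of_nat (Suc n)"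
      unfolding G_def by (rule nn_integral_divide) (intro borel_measurable_sum Z_meas)
    also have "\<dots> = (\<Sum>k<Suc n. \<integral>\<^sup>+X. Z (Suc q * Suc n) k X \<partial>walk) / of_nat (Suc n)"
      by (subst nn_integral_sum) (simp_all add: Z_meas)
    also have "\<dots> \<le> (\<Sum>k<Suc n. c) / of_nat (Suc n)"
      by (intro divide_right_mono_ennreal sum_mono Z_le)
    also have "\<dots> = c"
      using mult_divide_eq_ennreal[of "of_nat (Suc n)" c] by (simp add: mult.commute)
    finally show ?thesis .
  qed
  have "AE X in walk. of_nat q \<le> liminf (\<lambda>n. G n X)"
    using lim pos AE_walk_start
  proof eventually_elim
    fix X :: "nat \<Rightarrow> int"
    assume X: "(\<lambda>n. X n / n) \<longlonglongrightarrow> v" "\<exists>j0. \<forall>j\<ge>j0. 0 \<le> X j" "X 0 = 0"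
    have "\<forall>\<^sub>F n in sequentially. \<exists>J\<subseteq>{..<Suc q * Suc n}. q * Suc n \<le> card J \<and>
           (\<forall>j\<in>J. 0 \<le> X j \<and> (\<forall>i\<le>j. X i < int (Suc n)))"
      using eventually_slow_times[OF X(1) v X(2), of q]
      by (rule eventually_sequentially_Suc[THEN iffD2])
    then have "\<forall>\<^sub>F n in sequentially. of_nat q \<le> G n X"
    proof eventually_elim
      fix n assume "\<exists>J\<subseteq>{..<Suc q * Suc n}. q * Suc n \<le> card J \<and>
           (\<forall>j\<in>J. 0 \<le> X j \<and> (\<forall>i\<le>j. X i < int (Suc n)))"
      then obtain J where J: "J \<subseteq> {..<Suc q * Suc n}" "q * Suc n \<le> card J"
        "\<And>j. j \<in> J \<Longrightarrow> 0 \<le> X j \<and> (\<forall>i\<le>j. X i < int (Suc n))" by (elim exE conjE) auto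
      let ?S = "\<lambda>k. counted_times {int k} ((+) (int k) ` C) ((+) (int k) ` D) X"
      have "\<exists>k<Suc n. j \<in> ?S k" if "j \<in> J" for j
        using J(3)[OF that] by (intro cover[of X] X(3)) auto
      then have "card J \<le> (\<Sum>k<Suc n. card (?S k \<inter> {..<Suc q * Suc n}))"
        by (rule card_UN_counted_ge[OF finite_subset[OF J(1) finite_lessThan] J(1)])
      with J(2) have "q * Suc n \<le> (\<Sum>k<Suc n. card (?S k \<inter> {..<Suc q * Suc n}))"
        by (rule order_trans)
      then have "of_nat (q * Suc n) \<le> (of_nat (\<Sum>k<Suc n. card (?S k \<inter> {..<Suc q * Suc n})) :: ennreal)"
        by (simp only: of_nat_le_iff)
      also have "\<dots> \<le> (\<Sum>k<Suc n. Z (Suc q * Suc n) k X)"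
        unfolding of_nat_sum Z_def by (intro sum_mono after_hit_cnt_ge)
      finally have "of_nat (q * Suc n) / of_nat (Suc n) \<le> G n X"
        unfolding G_def by (rule divide_right_mono_ennreal)
      then show "of_nat q \<le> G n X"
        using mult_divide_eq_ennreal[of "of_nat (Suc n)" "of_nat q"]
        by (simp only: of_nat_mult) simp
    qed
    then show "of_nat q \<le> liminf (\<lambda>n. G n X)"
      by (rule Liminf_bounded)
  qed
  then have "(\<integral>\<^sup>+X. of_nat q \<partial>walk) \<le> (\<integral>\<^sup>+X. liminf (\<lambda>n. G n X) \<partial>walk)"
    by (rule nn_integral_mono_AE)
  also have "\<dots> \<le> liminf (\<lambda>n. \<integral>\<^sup>+X. G n X \<partial>walk)"
    by (rule nn_integral_liminf) (rule G_meas)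
  also have "\<dots> \<le> limsup (\<lambda>n. \<integral>\<^sup>+X. G n X \<partial>walk)"
    by (intro Liminf_le_Limsup) simp
  also have "\<dots> \<le> c"
    by (intro Limsup_bounded always_eventually allI G_le)
  finally have "of_nat q \<le> c"
    by (simp only: nn_integral_const_prob_space[OF prob_space_walk])
  with q show False
    by simp
qed

end

section \<open>Visits and hitting times\<close>

lemma visits_eq_Sup_cnt: "visits x X = (SUP n. cnt {x} {} n X)"
proof -
  have "visits x X = (\<Sum>j. indicator {n. X n = x} j)"
    by (simp add: visits_def nn_integral_count_space_nat[symmetric])
  also have "\<dots> = (SUP n. \<Sum>j<n. indicator {n. X n = x} j)"
    by (rule suminf_eq_SUP)
  also have "\<dots> = (SUP n. cnt {x} {} n X)"
    unfolding cnt_def indicator_def by (intro SUP_cong sum.cong refl) auto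
  finally show ?thesis .
qed

text \<open>The walk is killed on entering \<open>{x..}\<close>, so the entry time itself is not
  counted and exactly the times before it remain.\<close>

lemma hit_ge_eq_Sup_cnt: "ennreal_of_enat (hit_ge x X) = (SUP n. cnt UNIV {x..} n X)"
proof (cases rule: first_hit_cases[of X "{x..}"])
  case never
  then have "cnt UNIV {x..} n X = of_nat n" for n
    by (simp add: cnt_eq_card)
  moreover have "hit_ge x X = \<infinity>"
  proof -
    have "{n. x \<le> X n} = {}" using never by auto
    then show ?thesis by (simp add: hit_ge_def top_enat_def)
  qed
  ultimately show ?thesis
    by (simp add: ennreal_SUP_of_nat_eq_top)
next
  case (hit m)
  have "hit_ge x X = enat m"
    unfolding hit_ge_def
  proof (intro antisym INF_lower INF_greatest)
    fix n assume "n \<in> {n. x \<le> X n}"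
    then show "enat m \<le> enat n"
      using hit(2)[of n] by (cases "n < m") auto
  qed (use hit in auto)
  moreover have cnt: "cnt UNIV {x..} n X = of_nat (min n m)" for n
  proof -
    have "(\<forall>i\<le>j. X i \<notin> {x..}) \<longleftrightarrow> j < m" for j
      using hit by (meson le_trans linorder_not_less order_le_less_trans)
    then have "{j. j < n \<and> X j \<in> UNIV \<and> (\<forall>i\<le>j. X i \<notin> {x..})} = {..<min n m}"
      by auto
    then show ?thesis
      by (simp only: cnt_eq_card card_lessThan)
  qed
  have "(SUP n. cnt UNIV {x..} n X) = of_nat m"
  proof (rule antisym)
    show "(SUP n. cnt UNIV {x..} n X) \<le> of_nat m"
      unfolding cnt by (intro SUP_least) simp
    show "of_nat m \<le> (SUP n. cnt UNIV {x..} n X)"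
      by (rule SUP_upper2[of m]) (simp_all add: cnt)
  qed
  ultimately show ?thesis by simp
qed

lemma counted_timesI:
  assumes "i \<le> j" "X i \<in> A" "X j \<in> C" "\<And>i. i \<le> j \<Longrightarrow> X i \<notin> D"
  shows "j \<in> counted_times A C D X"
proof (cases rule: first_hit_cases[of X A])
  case never
  then show ?thesis using assms(2) by blast
next
  case (hit m)
  then have "m \<le> i"
    using assms(2) by (meson not_le)
  then show ?thesis
    using hit assms by (auto simp: counted_times_def intro!: exI[of _ m])
qed

text \<open>Time \<open>j\<close> is counted for the site \<open>X j\<close>.\<close>

lemma visits_cover:
  fixes X :: "nat \<Rightarrow> int"
  assumes "0 \<le> X j" "\<forall>i\<le>j. X i < int n"
  shows "\<exists>k<n. j \<in> counted_times {int k} ((+) (int k) ` {0}) ((+) (int k) ` {}) X"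
  using assms by (intro exI[of _ "nat (X j)"] conjI counted_timesI[of j]) auto

text \<open>Time \<open>j\<close> is counted for the running maximum \<open>k\<close>: it has been
  visited by then and \<open>{k + 1..}\<close> has not.\<close>

lemma hit_cover:
  fixes X :: "nat \<Rightarrow> int"
  assumes "X 0 = 0" "\<forall>i\<le>j. X i < int n"
  shows "\<exists>k<n. j \<in> counted_times {int k} ((+) (int k) ` UNIV) ((+) (int k) ` {1..}) X"
proof -
  define c where "c = Max (X ` {..j})"
  have "c \<in> X ` {..j}"
    unfolding c_def by (intro Max_in) auto
  then obtain i where i: "i \<le> j" "X i = c" by auto
  have c: "X l \<le> c" if "l \<le> j" for l
    unfolding c_def using that by (intro Max_ge) auto
  then have "c \<ge> 0"
    using assms(1) by force
  then show ?thesis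
    using i assms c by (intro exI[of _ "nat c"] conjI counted_timesI[of i]) (auto simp: surj_def, smt (verit))
qed

text \<open>If \<open>j\<close> is counted for \<open>k\<close> and \<open>k'\<close>, then the path
  has reached \<open>k'\<close> by time \<open>j\<close> but has stayed below
  \<open>k + (R + K)\<close>. So such sites lie within a window of length
  \<open>R + K\<close>.\<close>

lemma hit_few_small:
  fixes X :: "nat \<Rightarrow> int" and R K :: int and k :: nat
  assumes "0 \<le> R + K"
  defines "S \<equiv> \<lambda>k :: nat. counted_times {int k..} ((+) (k + R) ` UNIV) ((+) (k + R) ` {K..}) X"
  shows "finite {k. j \<in> S k} \<and> card {k. j \<in> S k} \<le> nat (R + K)" and "j \<in> S k \<Longrightarrow> X j \<le> k + (R + K)"
proof -
  have S: "j \<in> S k \<longleftrightarrow> (\<exists>m\<le>j. int k \<le> X m \<and> (\<forall>i<m. X i < int k) \<and> (\<forall>i\<in>{m..j}. X i < k + (R + K)))" for k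
  proof -
    have "range ((+) (k + R)) = UNIV" "(+) (k + R) ` {K..} = {k + (R + K)..}"
      by (simp, simp only: image_add_atLeast add.assoc)
    then show ?thesis
      unfolding S_def counted_times_def by (simp add: not_le) (simp add: add.assoc)
  qed
  show "j \<in> S k \<Longrightarrow> X j \<le> k + (R + K)"
    unfolding S by (meson atLeastAtMost_iff less_imp_le order_refl)
  show "finite {k. j \<in> S k} \<and> card {k. j \<in> S k} \<le> nat (R + K)"
  proof (rule card_le_if_spread)
    fix k k' assume "k \<in> {k. j \<in> S k}" "k' \<in> {k. j \<in> S k}"
    then obtain m m' where m: "m \<le> j" "\<forall>i<m. X i < int k" "\<forall>i\<in>{m..j}. X i < k + (R + K)"
      and m': "m' \<le> j" "int k' \<le> X m'"
      unfolding mem_Collect_eq S by blast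
    have "X m' < k + (R + K)"
    proof (cases "m' < m")
      case True
      then have "X m' < int k" using m by blast
      then show ?thesis using assms(1) by linarith
    qed (use m m' in auto)
    then show "k' < k + nat (R + K)"
      using m' assms(1) by linarith
  qed
qed

text \<open>A counted time satisfies \<open>X j = k + R\<close>, which determines
  \<open>k\<close>.\<close>

lemma visits_few_small:
  fixes X :: "nat \<Rightarrow> int" and R :: int and k :: nat
  defines "S \<equiv> \<lambda>k :: nat. counted_times {int k..} ((+) (k + R) ` {0}) ((+) (k + R) ` {}) X"
  shows "finite {k. j \<in> S k} \<and> card {k. j \<in> S k} \<le> 1" and "j \<in> S k \<Longrightarrow> X j \<le> k + R"
proof -
  have S: "X j = k + R" if "j \<in> S k" for k
    using that by (auto simp: S_def counted_times_def)
  then show "j \<in> S k \<Longrightarrow> X j \<le> k + R" by simp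
  show "finite {k. j \<in> S k} \<and> card {k. j \<in> S k} \<le> 1"
  proof (rule card_le_if_spread)
    fix k k' assume "k \<in> {k. j \<in> S k}" "k' \<in> {k. j \<in> S k}"
    then show "k' < k + 1" using S[of k] S[of k'] by simp
  qed
qed

text \<open>Almost surely every step follows an edge of \<open>E\<close>, so a site that
  \<open>E\<close> cannot reach from \<open>a\<close> has probability 0 at every time.\<close>

lemma irreducible_path:
  assumes irr: "irreducible_chain \<omega>" and E: "\<And>x y. trans_prob \<omega> x y \<noteq> 0 \<Longrightarrow> (x, y) \<in> E"
  shows "(a, b) \<in> E\<^sup>*"
proof (rule ccontr)
  assume ab: "(a, b) \<notin> E\<^sup>*"
  obtain n where n: "measure (quenched \<omega> a) {X. X n = b} > 0"
    using irr by (auto simp: irreducible_chain_def)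
  have "AE X in quenched \<omega> a. \<not> X n = b"
    using AE_quenched_start[of a \<omega>] AE_quenched_trans_prob[of \<omega> a]
  proof eventually_elim
    fix X :: "nat \<Rightarrow> int" assume X: "X 0 = a" "\<forall>n. trans_prob \<omega> (X n) (X (Suc n)) \<noteq> 0"
    have "(a, X n) \<in> E\<^sup>*" for n
      using X by (induction n) (auto intro: rtrancl_into_rtrancl E)
    then show "\<not> X n = b" using ab by metis
  qed
  moreover have "{X \<in> space path_space. X n = b} \<in> sets path_space"
    by measurable
  ultimately have "emeasure (quenched \<omega> a) {X. X n = b} = 0"
    by (subst (asm) AE_iff_measurable[where N = "{X. X n = b}"]) auto
  then show False
    using n by (simp add: measure_def)
qed

theorem theorem1p2:
  fixes P :: "(int \<Rightarrow> int pmf) measure" and v :: real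
  assumes "prob_space P" and "sets P = sets env_space"
    and "prob_space.indep_vars P (\<lambda>_. law_space) (\<lambda>x \<omega>. \<omega> x) UNIV"
    and "\<forall>x y. distr P law_space (\<lambda>\<omega>. \<omega> x) = distr P law_space (\<lambda>\<omega>. \<omega> y)"
    and "AE \<omega> in P. irreducible_chain \<omega>"
    and "\<exists>L R :: int. L > 0 \<and> R > 0 \<and>
           (AE \<omega> in P. \<forall>a b. b \<notin> {a - L..a + R} \<longrightarrow> trans_prob \<omega> a b = 0)"
    and "AE \<omega> in P. AE X in quenched \<omega> 0. filterlim X at_top sequentially"
    and "AE (\<omega>, X) in annealed P 0. (\<lambda>n. X n / n) \<longlonglongrightarrow> v"
  shows "(v > 0 \<longleftrightarrow> (\<integral>\<^sup>+(\<omega>, X). hit_ge 1 X \<partial>annealed P 0) < \<infinity>) \<and>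
         ((\<integral>\<^sup>+(\<omega>, X). hit_ge 1 X \<partial>annealed P 0) < \<infinity> \<longleftrightarrow>
          (\<integral>\<^sup>+(\<omega>, X). visits 0 X \<partial>annealed P 0) = (\<integral>\<^sup>+\<omega>. \<integral>\<^sup>+X. visits 0 X \<partial>quenched \<omega> 0 \<partial>P) \<and>
          (\<integral>\<^sup>+\<omega>. \<integral>\<^sup>+X. visits 0 X \<partial>quenched \<omega> 0 \<partial>P) < \<infinity>)"
proof -
  interpret P: prob_space P by fact
  note sets_P [measurable_cong] = assms(2)
  define \<mu> where "\<mu> = distr P law_space (\<lambda>\<omega>. \<omega> 0)"
  have comp: "(\<lambda>\<omega>. \<omega> a) \<in> measurable P law_space" for a
    unfolding measurable_cong_sets[OF sets_P refl] by (rule measurable_env_component)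
  have sets_law: "sets \<mu> = sets law_space"
    by (simp add: \<mu>_def)
  interpret iid_environment \<mu>
    by (rule iid_environment.intro) (simp_all add: sets_law, simp add: \<mu>_def P.prob_space_distr comp)
  \<comment> \<open>The identity pushes \<open>P\<close> from the Borel \<sigma>-algebra down to the
    product one, where independence and equal marginals identify the law as
    \<open>env\<close>.\<close>
  have id: "(\<lambda>\<omega>. \<omega>) \<in> measurable P env_product"
    by (rule measurable_PiM_single') (simp_all add: comp)
  have env_eq: "env = distr P env_product (\<lambda>\<omega>. \<omega>)"
  proof -
    have "distr P env_product (\<lambda>\<omega>. \<lambda>i\<in>UNIV. \<omega> i) = PiM UNIV (\<lambda>i. distr P law_space (\<lambda>\<omega>. \<omega> i))"
      using assms(3) by (subst (asm) P.indep_vars_iff_distr_eq_PiM') (simp_all add: comp)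
    moreover have "(\<lambda>i. distr P law_space (\<lambda>\<omega>. \<omega> i)) = (\<lambda>_. \<mu>)"
      using assms(4) unfolding \<mu>_def by metis
    ultimately show ?thesis
      by (simp add: env_def restrict_def)
  qed
  have int_env: "(\<integral>\<^sup>+\<omega>. F \<omega> \<partial>env) = (\<integral>\<^sup>+\<omega>. F \<omega> \<partial>P)" if "F \<in> borel_measurable env_product" for F
    unfolding env_eq using that by (intro nn_integral_distr id) simp
  have AE_env: "(AE \<omega> in env. Q \<omega>) \<longleftrightarrow> (AE \<omega> in P. Q \<omega>)" if "Measurable.pred env_product Q" for Q
    unfolding env_eq using that by (intro AE_distr_iff id) (simp add: pred_def)
  have annealed: "(\<integral>\<^sup>+(\<omega>, X). F X \<partial>annealed P 0) = (\<integral>\<^sup>+\<omega>. \<integral>\<^sup>+X. F X \<partial>quenched \<omega> 0 \<partial>P)"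
    if F: "F \<in> borel_measurable path_space" for F
    using measurable_compose[OF measurable_snd F]
    by (subst nn_integral_annealed[OF assms(1,2)]) (simp_all add: split_beta')
  have finite_iff: "(\<integral>\<^sup>+(\<omega>, X). F X \<partial>annealed P 0) < \<infinity> \<longleftrightarrow> bounded_green C D"
    if F: "F \<in> borel_measurable path_space" "\<And>X. F X = (SUP n. cnt C D n X)" for F C D
    using nn_integral_Sup_cnt_less_top_iff[OF F(2)]
    by (simp add: annealed[OF F(1)] int_env measurable_nn_integral_quenched[OF F(1)])
  have hit_meas: "(\<lambda>X. ennreal_of_enat (hit_ge 1 X)) \<in> borel_measurable path_space"
    by (rule measurable_compose[OF measurable_hit_ge]) simp
  have b_iff: "(\<integral>\<^sup>+(\<omega>, X). hit_ge 1 X \<partial>annealed P 0) < \<infinity> \<longleftrightarrow> bounded_green UNIV {1..}"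
    using finite_iff[OF hit_meas hit_ge_eq_Sup_cnt] by (simp add: split_beta')
  note c_iff = finite_iff[OF measurable_visits visits_eq_Sup_cnt]
  note c_eq = annealed[OF measurable_visits]
  obtain L R :: int where R: "R > 0"
    and range: "AE \<omega> in P. \<forall>a b. b \<notin> {a - L..a + R} \<longrightarrow> trans_prob \<omega> a b = 0"
    using assms(6) by blast
  have lim: "AE X in walk. (\<lambda>n. X n / n) \<longlonglongrightarrow> v"
  proof -
    \<comment> \<open>The two laws live on different spaces; the probability of the path event
      \<open>B\<close> is compared through its quenched probabilities.\<close>
    define B where "B = {X :: nat \<Rightarrow> int. \<not> (\<lambda>n. X n / n) \<longlonglongrightarrow> v}"
    have "{X \<in> space path_space. \<not> (\<lambda>n. X n / n) \<longlonglongrightarrow> v} \<in> sets path_space"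
      by measurable
    then have B: "B \<in> sets path_space" by (simp add: B_def)
    have "emeasure (annealed P 0) (UNIV \<times> B) = 0"
    proof (subst AE_iff_measurable[symmetric])
      show "UNIV \<times> B \<in> sets (annealed P 0)"
        using B sets.top[of env_space] by (simp add: sets_annealed[OF assms(1,2)] pair_measureI)
      show "{z \<in> space (annealed P 0). \<not> (case z of (\<omega>, X) \<Rightarrow> (\<lambda>n. X n / n) \<longlonglongrightarrow> v)} = UNIV \<times> B"
        using sets_eq_imp_space_eq[OF sets_annealed[OF assms(1,2), of 0]]
        by (auto simp: B_def space_pair_measure)
    qed (rule assms(8))
    moreover have "emeasure (annealed P 0) (UNIV \<times> B) = (\<integral>\<^sup>+\<omega>. emeasure (quenched \<omega> 0) B \<partial>P)"
      using emeasure_annealed_Times[OF assms(1,2) _ B, of UNIV 0] sets.top[of env_space] by simp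
    moreover have "emeasure walk B = (\<integral>\<^sup>+\<omega>. emeasure (quenched \<omega> 0) B \<partial>P)"
    proof -
      have ind: "(indicator B :: _ \<Rightarrow> ennreal) \<in> borel_measurable path_space"
        using B by simp
      have "emeasure walk B = (\<integral>\<^sup>+X. indicator B X \<partial>walk)"
        using B by simp
      also have "\<dots> = (\<integral>\<^sup>+\<omega>. \<integral>\<^sup>+X. indicator B X \<partial>quenched \<omega> 0 \<partial>P)"
        by (simp only: nn_integral_walk[OF ind] int_env[OF measurable_nn_integral_quenched[OF ind]])
      finally show ?thesis using B by simp
    qed
    ultimately have "emeasure walk B = 0" by simp
    then show ?thesis
      using B sets_eq_imp_space_eq[OF sets_walk] by (subst AE_iff_measurable[where N = B]) (simp_all add: B_def)
  qed
  have pos: "AE X in walk. \<exists>j0. \<forall>j\<ge>j0. 0 \<le> X j"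
  proof (subst AE_walk)
    show "AE \<omega> in env. AE X in quenched \<omega> 0. \<exists>j0. \<forall>j\<ge>j0. 0 \<le> X j"
    proof (subst AE_env[OF pred_AE_quenched])
      show "AE \<omega> in P. AE X in quenched \<omega> 0. \<exists>j0. \<forall>j\<ge>j0. 0 \<le> X j"
        using assms(7)
      proof eventually_elim
        fix \<omega> assume "AE X in quenched \<omega> 0. filterlim X at_top sequentially"
        then show "AE X in quenched \<omega> 0. \<exists>j0. \<forall>j\<ge>j0. 0 \<le> X j"
          by eventually_elim (auto simp: filterlim_at_top eventually_sequentially)
      qed
    qed measurable
  qed measurable
  have jumps: "AE X in walk. \<forall>n. X (Suc n) \<le> X n + R"
  proof (subst AE_walk)
    have "AE \<omega> in env. \<forall>a b. b \<notin> {a - L..a + R} \<longrightarrow> trans_prob \<omega> a b = 0"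
      by (subst AE_env) (measurable, rule range)
    then show "AE \<omega> in env. AE X in quenched \<omega> 0. \<forall>n. X (Suc n) \<le> X n + R"
    proof eventually_elim
      fix \<omega> assume \<omega>: "\<forall>a b. b \<notin> {a - L..a + R} \<longrightarrow> trans_prob \<omega> a b = 0"
      show "AE X in quenched \<omega> 0. \<forall>n. X (Suc n) \<le> X n + R"
        using AE_quenched_trans_prob[of \<omega> 0]
        by eventually_elim (metis \<omega> atLeastAtMost_iff)
    qed
  qed (intro pred_intros_countable measurable_path_pair, simp)
  \<comment> \<open>The graph \<open>edge\<close> is deterministic, so irreducibility of almost
    every environment connects all its sites.\<close>
  have edges: "(a, b) \<in> edge\<^sup>*" for a b
  proof -
    have "AE \<omega> in P. \<forall>a b. trans_prob \<omega> a b \<noteq> 0 \<longrightarrow> (a, b) \<in> edge"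
    proof (subst AE_all_countable, rule allI, subst AE_all_countable, rule allI)
      fix a b
      have "(\<lambda>\<omega>. ennreal (trans_prob \<omega> a b)) \<in> borel_measurable env_product"
        by measurable
      note int = int_env[OF this]
      have meas: "(\<lambda>\<omega>. ennreal (trans_prob \<omega> a b)) \<in> borel_measurable P"
        by measurable
      have "AE \<omega> in P. ennreal (trans_prob \<omega> a b) = 0" if "(a, b) \<notin> edge"
        using that int nn_integral_0_iff_AE[OF meas] by (simp only: edge_def mem_Collect_eq prod.case not_not)
      then show "AE \<omega> in P. trans_prob \<omega> a b \<noteq> 0 \<longrightarrow> (a, b) \<in> edge"
        by (cases "(a, b) \<in> edge") (auto simp: trans_prob_def)
    qed
    with assms(5) have "AE \<omega> in P. (a, b) \<in> edge\<^sup>*"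
      by eventually_elim (rule irreducible_path, auto)
    then show ?thesis by simp
  qed
  obtain W c m where W: "finite W" "0 \<in> W" "c < \<top>" "dominates c m W" "{- R..-1} \<subseteq> W"
    using dominating_superset[of "{- R..-1}"] edges by (auto simp: dominating_def)
  \<comment> \<open>The comparison needs \<open>W\<close> outside the absorbing set, so \<open>H\<^sub>\<ge>\<^sub>1\<close> is bounded through some \<open>H\<^sub>\<ge>\<^sub>K\<close>.\<close>
  define K where "K = max 1 (Max W + 1)"
  have K: "K \<ge> 1" "{K..} \<inter> W = {}"
    using Max_ge[OF W(1)] by (auto simp: K_def) (smt (verit))
  \<comment> \<open>Each time is a visit to at most one target \<open>k + R\<close>, hence
    \<open>B = 1\<close> and \<open>K = R\<close>.\<close>
  have "v > 0 \<Longrightarrow> bounded_green {0} {}"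
    using visits_few_small
    by (intro bounded_green_if_ballistic[OF lim _ jumps R W(4,3,5), where B = 1 and K = R]) auto
  moreover have "bounded_green {0} {} \<Longrightarrow> v > 0"
    using visits_cover by (intro ballistic_if_bounded_green[OF lim pos])
  moreover have "bounded_green UNIV {1..}" if "v > 0"
  proof -
    have "bounded_green UNIV {K..}"
      using hit_few_small[of R K] R K
      by (intro bounded_green_if_ballistic[OF lim that jumps R W(4,3,5), where B = "nat (R + K)" and K = "R + K"]) auto
    then obtain d where "d < \<top>" "\<And>n. (\<integral>\<^sup>+\<omega>. green \<omega> UNIV {K..} n 0 \<partial>env) \<le> d"
      unfolding bounded_green_def by (elim exE conjE) auto
    \<comment> \<open>As \<open>K \<ge> 1\<close>, the walk enters \<open>{1..}\<close> no later
      than \<open>{K..}\<close>.\<close>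
    moreover have "(\<integral>\<^sup>+\<omega>. green \<omega> UNIV {1..} n 0 \<partial>env) \<le> (\<integral>\<^sup>+\<omega>. green \<omega> UNIV {K..} n 0 \<partial>env)" for n
      using K(1) by (intro nn_integral_mono green_antimono) auto
    ultimately show ?thesis
      unfolding bounded_green_def by (intro exI[of _ d] conjI allI) (auto intro: order_trans)
  qed
  moreover have "bounded_green UNIV {1..} \<Longrightarrow> v > 0"
    using hit_cover by (intro ballistic_if_bounded_green[OF lim pos])
  ultimately show ?thesis
    unfolding b_iff c_eq[symmetric] c_iff by blast
qed

end
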